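(* Let $\mathbb{K}$ be an algebraically closed field of characteristic zero and let $D$ be a simple derivation of $\mathbb{K}[x,y]$. Then $\mathrm{Aut}(D)=\{\mathrm{id}\}$.
   Context: A derivation of $\mathbb{K}[x,y]$ is a $\mathbb{K}$-linear map $D:\mathbb{K}[x,y]\to\mathbb{K}[x,y]$ with $D(fg)=gD(f)+fD(g)$. $D$ is simple if it does not stabilize any nontrivial ideal, i.e. there is no ideal $I$ with $(0)\neq I\neq \mathbb{K}[x,y]$ and $D(I)\subseteq I$. $\mathrm{Aut}(D)$ denotes the group of $\mathbb{K}$-algebra automorphisms $\rho$ of $\mathbb{K}[x,y]$ with $\rho D=D\rho$. *)

theory Defs
  imports "HOL-Computational_Algebra.Polynomial"
begin

text \<open>The polynomial ring K[x,y] is represented as K[x][y], i.e. the type 'a poly poly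
  (inner variable x, outer variable y). The constant c of K is [:[:c:]:].\<close>

type_synonym 'a bipoly = "'a poly poly"

definition bconst :: "'a::zero \<Rightarrow> 'a bipoly" where
  "bconst c = [:[:c:]:]"

definition is_derivation :: "('a::field bipoly \<Rightarrow> 'a bipoly) \<Rightarrow> bool" where
  "is_derivation D \<longleftrightarrow>
     (\<forall>f g. D (f + g) = D f + D g) \<and>
     (\<forall>c f. D (bconst c * f) = bconst c * D f) \<and>
     (\<forall>f g. D (f * g) = g * D f + f * D g)"

definition is_ideal :: "'a::comm_ring_1 set \<Rightarrow> bool" where
  "is_ideal I \<longleftrightarrow> 0 \<in> I \<and> (\<forall>a\<in>I. \<forall>b\<in>I. a + b \<in> I) \<and> (\<forall>r. \<forall>a\<in>I. r * a \<in> I)"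

definition simple_derivation :: "('a::field bipoly \<Rightarrow> 'a bipoly) \<Rightarrow> bool" where
  "simple_derivation D \<longleftrightarrow> is_derivation D \<and>
     \<not> (\<exists>I. is_ideal I \<and> I \<noteq> {0} \<and> I \<noteq> UNIV \<and> D ` I \<subseteq> I)"

definition is_K_algebra_aut :: "('a::field bipoly \<Rightarrow> 'a bipoly) \<Rightarrow> bool" where
  "is_K_algebra_aut \<rho> \<longleftrightarrow> bij \<rho> \<and>
     (\<forall>f g. \<rho> (f + g) = \<rho> f + \<rho> g) \<and>
     (\<forall>f g. \<rho> (f * g) = \<rho> f * \<rho> g) \<and>
     (\<forall>c. \<rho> (bconst c) = bconst c)"

definition Aut_der :: "('a::field bipoly \<Rightarrow> 'a bipoly) \<Rightarrow> ('a bipoly \<Rightarrow> 'a bipoly) set" where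
  "Aut_der D = {\<rho>. is_K_algebra_aut \<rho> \<and> \<rho> \<circ> D = D \<circ> \<rho>}"

end

theory Submission
  imports Defs
begin

text \<open>
  Let \<open>\<rho>\<close> be an automorphism that commutes with the simple derivation \<open>D\<close>. The ideal of the fixed points
  of \<open>\<rho>\<close>, generated by all \<open>\<rho> h - h\<close>, is \<open>D\<close>-stable, hence \<open>\<rho> = id\<close> or this ideal is the whole ring.

  By Jung's theorem the automorphism group is generated by triangular automorphisms and the swap.
  (If \<open>f, g\<close> are the components of an automorphism, of degrees \<open>m, n\<close>, then \<open>P(f, g) = x\<close>
  for some \<open>P\<close>. Taking \<open>q\<close> derivatives of \<open>P\<close> in the second variable until its leading part no longer
  vanishes at the leading forms of \<open>f\<close> and \<open>g\<close>, and bounding degrees by the Jacobian, yields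
  \<open>lcm m n < m + n\<close>. So one degree divides the other, and the leading forms are proportional after
  taking a power.) Cyclic reduction of words then shows that \<open>\<rho>\<close> is conjugate to a triangular
  automorphism or to a composition of generalised Henon maps of degrees at least two.

  In the second case the equations of the fixed points have leading forms without a common zero, so they do
  not generate the unit ideal. In the first case \<open>\<rho>\<close> has a fixed point, or \<open>D\<close> stabilises a line that
  is invariant under \<open>\<rho>\<close>, or, in suitable coordinates, \<open>D x\<close> and \<open>D y\<close> depend on a single variable,
  so that \<open>D\<close> stabilises a principal ideal.
\<close>

section \<open>Homomorphisms of the polynomial ring in two variables\<close>

text \<open>Conjugating \<open>\<rho>\<close> and \<open>D\<close> by the same automorphism keeps
  \<open>D\<close> simple and keeps the two commuting, so one representative of each conjugacy class
  of automorphisms is enough. The ideal of the fixed points alone cannot settle the triangular case: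
  y -> y + 1 has no fixed point. There the commutation with \<open>D\<close> has to be used a second
  time, either to restrict \<open>D x\<close> and \<open>D y\<close> or to produce a stable ideal.
  For a composition of at least two Henon maps the obstacle is at infinity: both components have a
  power of x as leading form, so the leading forms of the equations \<open>\<rho> x = x\<close> and
  \<open>\<rho> y = y\<close> have a common zero. For this reason the ideal of the fixed points is
  generalised to the coincidence ideal of two homomorphisms. The word is cut near its middle and one
  half is moved to the other side, where inversion turns powers of x into powers of y. Algebraic
  closedness enters only through an eigenvector of a linear map, when affine automorphisms are made
  triangular.\<close>

definition bX :: "'a::comm_semiring_1 bipoly" where "bX = [:[:0, 1:]:]"

definition bY :: "'a::comm_semiring_1 bipoly" where "bY = [:0, 1:]"

text \<open>Identities between homomorphisms, derivations or Jacobians have to be checked only on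
  constants and on the two variables.\<close>

lemma bipoly_induct [case_names const X Y add mult]:
  fixes f :: "'a::comm_semiring_1 bipoly"
  assumes const: "\<And>c. P (bconst c)" and X: "P bX" and Y: "P bY"
    and add: "\<And>f g. P f \<Longrightarrow> P g \<Longrightarrow> P (f + g)"
    and mult: "\<And>f g. P f \<Longrightarrow> P g \<Longrightarrow> P (f * g)"
  shows "P f"
proof (induction f)
  case 0
  then show ?case using const[of 0] by (simp add: bconst_def)
next
  case (pCons p f)
  have "P [:p:]"
  proof (induction p)
    case 0
    then show ?case using const[of 0] by (simp add: bconst_def)
  next
    case (pCons c p)
    have "[:pCons c p:] = bconst c + bX * [:p:]"
      by (simp add: bconst_def bX_def)
    then show ?case using add mult const X pCons by metis
  qed
  moreover have "pCons p f = [:p:] + bY * f"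
    by (simp add: bY_def)
  ultimately show ?case using add mult Y pCons by metis
qed

definition alg_hom :: "('a::field bipoly \<Rightarrow> 'a bipoly) \<Rightarrow> bool" where
  "alg_hom \<rho> \<longleftrightarrow>
     (\<forall>f g. \<rho> (f + g) = \<rho> f + \<rho> g) \<and>
     (\<forall>f g. \<rho> (f * g) = \<rho> f * \<rho> g) \<and>
     (\<forall>c. \<rho> (bconst c) = bconst c)"

lemma aut_iff: "is_K_algebra_aut \<rho> \<longleftrightarrow> bij \<rho> \<and> alg_hom \<rho>"
  by (auto simp: is_K_algebra_aut_def alg_hom_def)

lemma aut_hom: "is_K_algebra_aut \<rho> \<Longrightarrow> alg_hom \<rho>"
  by (simp add: aut_iff)

lemma hom_add: "alg_hom \<rho> \<Longrightarrow> \<rho> (f + g) = \<rho> f + \<rho> g"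
  and hom_mult: "alg_hom \<rho> \<Longrightarrow> \<rho> (f * g) = \<rho> f * \<rho> g"
  and hom_const: "alg_hom \<rho> \<Longrightarrow> \<rho> (bconst c) = bconst c"
  by (auto simp: alg_hom_def)

lemma bconst_0: "bconst 0 = 0" and bconst_1: "bconst 1 = 1"
  and bconst_add: "bconst (a + b) = bconst a + bconst b"
  by (auto simp: bconst_def one_pCons)

lemma bconst_mult: "bconst (a * b) = bconst a * bconst (b :: 'a::comm_semiring_0)"
  by (auto simp: bconst_def)

lemma bconst_minus: "bconst (- a) = - bconst (a :: 'a::ab_group_add)"
  and bconst_diff: "bconst (a - b) = bconst a - bconst (b :: 'a::ab_group_add)"
  by (auto simp: bconst_def)

lemma bconst_eq_iff [simp]: "bconst a = bconst b \<longleftrightarrow> a = b"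
  by (simp add: bconst_def)

lemma bconst_eq_0_iff [simp]: "bconst a = 0 \<longleftrightarrow> a = 0"
  by (simp add: bconst_def)

lemma hom_0: "alg_hom \<rho> \<Longrightarrow> \<rho> 0 = 0" and hom_1: "alg_hom \<rho> \<Longrightarrow> \<rho> 1 = 1"
  using hom_const[of \<rho> 0] hom_const[of \<rho> 1] by (auto simp: bconst_0 bconst_1)

lemma hom_minus: "alg_hom \<rho> \<Longrightarrow> \<rho> (- f) = - \<rho> f"
  using hom_add[of \<rho> f "- f"] by (auto simp: hom_0 eq_neg_iff_add_eq_0 add.commute)

lemma hom_diff: "alg_hom \<rho> \<Longrightarrow> \<rho> (f - g) = \<rho> f - \<rho> g"
  using hom_add[of \<rho> f "- g"] by (simp add: hom_minus)

lemma hom_power: "alg_hom \<rho> \<Longrightarrow> \<rho> (f ^ n) = \<rho> f ^ n"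
  by (induction n) (auto simp: hom_1 hom_mult)

lemma hom_sum: "alg_hom \<rho> \<Longrightarrow> \<rho> (sum f A) = (\<Sum>i\<in>A. \<rho> (f i))"
  by (induction A rule: infinite_finite_induct) (auto simp: hom_0 hom_add)

lemmas hom_simps = hom_add hom_mult hom_const hom_0 hom_1 hom_minus hom_diff hom_power

lemma hom_eqI:
  assumes "alg_hom \<rho>" "alg_hom \<sigma>" "\<rho> bX = \<sigma> bX" "\<rho> bY = \<sigma> bY"
  shows "\<rho> = \<sigma>"
proof
  show "\<rho> f = \<sigma> f" for f
    by (induction f rule: bipoly_induct) (use assms in \<open>auto simp: hom_simps\<close>)
qed

lemma hom_id: "alg_hom id"
  by (simp add: alg_hom_def)

lemma hom_comp: "alg_hom \<rho> \<Longrightarrow> alg_hom \<sigma> \<Longrightarrow> alg_hom (\<rho> \<circ> \<sigma>)"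
  by (simp add: alg_hom_def)

lemma hom_inv:
  assumes "is_K_algebra_aut \<rho>"
  shows "alg_hom (inv \<rho>)"
proof -
  have b: "bij \<rho>" and h: "alg_hom \<rho>" using assms by (auto simp: aut_iff)
  have surj: "\<rho> (inv \<rho> f) = f" for f using b by (simp add: bij_is_surj surj_f_inv_f)
  have "inv \<rho> (\<rho> f) = f" for f using b by (simp add: bij_is_inj)
  then have "inv \<rho> (f + g) = inv \<rho> f + inv \<rho> g" "inv \<rho> (f * g) = inv \<rho> f * inv \<rho> g"
    "inv \<rho> (bconst c) = bconst c" for f g c
    using surj hom_simps[OF h] by metis+
  then show ?thesis by (simp add: alg_hom_def)
qed

lemma aut_id: "is_K_algebra_aut id"
  by (simp add: aut_iff hom_id)

lemma aut_comp: "is_K_algebra_aut \<rho> \<Longrightarrow> is_K_algebra_aut \<sigma> \<Longrightarrow> is_K_algebra_aut (\<rho> \<circ> \<sigma>)"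
  by (simp add: aut_iff hom_comp bij_comp)

lemma aut_inv: "is_K_algebra_aut \<rho> \<Longrightarrow> is_K_algebra_aut (inv \<rho>)"
  using hom_inv by (simp add: aut_iff bij_imp_bij_inv)

lemma aut_inv_right: "is_K_algebra_aut \<rho> \<Longrightarrow> \<rho> \<circ> inv \<rho> = id"
  by (simp add: aut_iff bij_is_surj flip: surj_iff)

lemma aut_inv_left_apply: "is_K_algebra_aut \<rho> \<Longrightarrow> inv \<rho> (\<rho> f) = f"
  and aut_inv_right_apply: "is_K_algebra_aut \<rho> \<Longrightarrow> \<rho> (inv \<rho> f) = f"
  by (simp_all add: aut_iff bij_is_inj bij_is_surj surj_f_inv_f)

section \<open>Substitution homomorphisms and the exchange of the variables\<close>

definition bsubst :: "'a::field bipoly \<Rightarrow> 'a bipoly \<Rightarrow> 'a bipoly \<Rightarrow> 'a bipoly" where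
  "bsubst a b f = poly (map_poly (\<lambda>p. poly (map_poly bconst p) a) f) b"

lemma bsubst_0: "bsubst a b 0 = 0"
  by (simp add: bsubst_def)

lemma bsubst_pCons: "bsubst a b (pCons p f) = bsubst a b [:p:] + b * bsubst a b f"
  by (simp add: bsubst_def map_poly_pCons bconst_0)

lemma bsubst_const_pCons: "bsubst a b [:pCons c p:] = bconst c + a * bsubst a b [:p:]"
  by (simp add: bsubst_def map_poly_pCons bconst_0)

lemma bsubst_add: "bsubst a b (f + g) = bsubst a b f + bsubst a b g"
proof (induction f g rule: poly_induct2)
  case 0
  then show ?case by (simp add: bsubst_0)
next
  case (pCons p f q g)
  have "bsubst a b [:p + q:] = bsubst a b [:p:] + bsubst a b [:q:]"
  proof (induction p q rule: poly_induct2)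
    case 0
    then show ?case by (simp add: bsubst_0)
  next
    case (pCons c p d q)
    then show ?case
      by (simp only: add_pCons bsubst_const_pCons bconst_add) (simp add: algebra_simps)
  qed
  then show ?case using pCons
    by (simp only: add_pCons bsubst_pCons[of a b _ f] bsubst_pCons[of a b _ g] bsubst_pCons[of a b _ "f + g"])
       (simp add: algebra_simps)
qed

lemma bsubst_smult_const: "bsubst a b (bconst c * f) = bconst c * bsubst a b f"
proof (induction f)
  case (pCons p f)
  have "bsubst a b [:smult c p:] = bconst c * bsubst a b [:p:]"
  proof (induction p)
    case (pCons d p)
    then show ?case
      by (simp only: smult_pCons bsubst_const_pCons bconst_mult) (simp add: algebra_simps)
  qed (simp add: bsubst_0)
  moreover have "bconst c * pCons p f = pCons (smult c p) (bconst c * f)"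
    by (simp add: bconst_def)
  ultimately show ?case using pCons
    by (simp only: bsubst_pCons[of a b _ f] bsubst_pCons[of a b _ "bconst c * f"])
       (simp add: algebra_simps)
qed (simp add: bsubst_0)

lemma bsubst_X_mult: "bsubst a b (bX * f) = a * bsubst a b f"
proof (induction f)
  case (pCons p f)
  have "bX * pCons p f = pCons (pCons 0 p) (bX * f)"
    by (simp add: bX_def)
  moreover have "bsubst a b [:pCons 0 p:] = a * bsubst a b [:p:]"
    by (simp only: bsubst_const_pCons bconst_0) simp
  ultimately show ?case using pCons
    by (simp only: bsubst_pCons[of a b _ f] bsubst_pCons[of a b _ "bX * f"])
       (simp add: algebra_simps)
qed (simp add: bsubst_0)

lemma bsubst_Y_mult: "bsubst a b (bY * f) = b * bsubst a b f"
  using bsubst_pCons[of a b 0 f] by (simp add: bY_def bsubst_0)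

lemma bsubst_const: "bsubst a b (bconst c) = bconst c"
  using bsubst_const_pCons[of a b c 0] by (simp add: bconst_def bsubst_0)

lemma bsubst_X [simp]: "bsubst a b bX = a" and bsubst_Y [simp]: "bsubst a b bY = b"
  using bsubst_X_mult[of a b 1] bsubst_Y_mult[of a b 1] bsubst_const[of a b 1]
  by (simp_all add: bconst_1)

lemma bsubst_mult: "bsubst a b (f * g) = bsubst a b f * bsubst a b g"
proof (induction f arbitrary: g rule: bipoly_induct)
  case (const c)
  then show ?case by (simp add: bsubst_smult_const bsubst_const)
next
  case X
  then show ?case by (simp add: bsubst_X_mult)
next
  case Y
  then show ?case by (simp add: bsubst_Y_mult)
next
  case (add f h)
  then show ?case by (simp add: distrib_right bsubst_add)
next
  case (mult f h)
  then show ?case by (simp add: mult.assoc)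
qed

lemma hom_bsubst: "alg_hom (bsubst a b)"
  by (simp add: alg_hom_def bsubst_add bsubst_mult bsubst_const)

lemma hom_eq_bsubst: "alg_hom \<rho> \<Longrightarrow> \<rho> = bsubst (\<rho> bX) (\<rho> bY)"
  by (rule hom_eqI) (auto simp: hom_bsubst)

lemma aut_bsubstI:
  assumes "bsubst a b a' = bX" "bsubst a b b' = bY" "bsubst a' b' a = bX" "bsubst a' b' b = bY"
  shows "is_K_algebra_aut (bsubst a b)"
proof -
  have "bsubst a b \<circ> bsubst a' b' = id" "bsubst a' b' \<circ> bsubst a b = id"
    by (rule hom_eqI; use assms in \<open>simp add: hom_comp hom_id hom_bsubst\<close>)+
  then have "bij (bsubst a b)" by (metis o_bij)
  then show ?thesis by (simp add: aut_iff hom_bsubst)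
qed

lemma bipoly_eq_sum: "(f :: 'a::field bipoly) =
    (\<Sum>j\<le>degree f. \<Sum>i\<le>degree (coeff f j). bconst (coeff (coeff f j) i) * bX ^ i * bY ^ j)"
proof -
  have Y: "bY ^ j = monom 1 j" for j :: nat
    by (simp add: bY_def monom_altdef)
  have X: "bconst c * bX ^ i = [:monom c i:]" for c :: 'a and i
  proof -
    have "(bX :: 'a bipoly) ^ i = [:[:0, 1:] ^ i:]" for i
      by (induction i) (auto simp: bX_def one_pCons)
    then show ?thesis by (simp add: bconst_def monom_altdef)
  qed
  have "(\<Sum>i\<le>degree p. [:monom (coeff p i) i:]) = [:p:]" for p :: "'a poly"
  proof -
    have "(\<Sum>i\<in>A. [:h i:]) = [:sum h A:]" for h :: "nat \<Rightarrow> 'a poly" and A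
      by (induction A rule: infinite_finite_induct) auto
    then show ?thesis by (simp add: poly_as_sum_of_monoms)
  qed
  then show ?thesis
    by (simp only: X Y flip: sum_distrib_right) (simp add: smult_monom poly_as_sum_of_monoms)
qed

lemma hom_expand:
  assumes "alg_hom \<rho>"
  shows "\<rho> f = (\<Sum>j\<le>degree f. \<Sum>i\<le>degree (coeff f j).
           bconst (coeff (coeff f j) i) * \<rho> bX ^ i * \<rho> bY ^ j)"
  by (subst (1) bipoly_eq_sum) (simp only: hom_sum[OF assms] hom_simps[OF assms])

lemma const_poly_as_hom:
  assumes "alg_hom \<rho>" "\<rho> bX = [:q:]"
  shows "\<rho> [:p:] = [:pcompose p q:]"
proof (induction p)
  case 0
  then show ?case by (simp add: hom_0[OF assms(1)])
next
  case (pCons c p)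
  have "[:pCons c p:] = bconst c + bX * [:p:]"
    by (simp add: bconst_def bX_def)
  then have "\<rho> [:pCons c p:] = bconst c + \<rho> bX * \<rho> [:p:]"
    by (simp only: hom_simps[OF assms(1)])
  then show ?case using pCons assms by (simp add: bconst_def pcompose_pCons)
qed

definition bswap :: "'a::field bipoly \<Rightarrow> 'a bipoly" where
  "bswap = bsubst bY bX"

lemma aut_bswap: "is_K_algebra_aut bswap"
  unfolding bswap_def by (rule aut_bsubstI[where a' = bY and b' = bX]) auto

lemma hom_bswap: "alg_hom bswap"
  by (simp add: aut_hom aut_bswap)

lemma bswap_X [simp]: "bswap bX = bY" and bswap_Y [simp]: "bswap bY = bX"
  by (simp_all add: bswap_def)

lemma bswap_comp_bswap: "bswap \<circ> bswap = id"
  by (rule hom_eqI) (auto simp: hom_comp hom_bswap hom_id)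

lemma bswap_bswap [simp]: "bswap (bswap f) = f"
  using bswap_comp_bswap by (metis comp_apply id_apply)

section \<open>Simple derivations\<close>

lemma der_add: "is_derivation D \<Longrightarrow> D (f + g) = D f + D g"
  and der_scale: "is_derivation D \<Longrightarrow> D (bconst c * f) = bconst c * D f"
  and der_mult: "is_derivation D \<Longrightarrow> D (f * g) = g * D f + f * D g"
  by (auto simp: is_derivation_def)

lemma der_1: "is_derivation D \<Longrightarrow> D 1 = 0"
  using der_mult[of D 1 1] by (metis add_cancel_left_left mult_1)

lemma der_const: "is_derivation D \<Longrightarrow> D (bconst c) = 0"
  using der_scale[of D c 1] der_1[of D] by simp

lemma der_0: "is_derivation D \<Longrightarrow> D 0 = 0"
  using der_const[of D 0] by (simp add: bconst_0)

lemma der_diff: "is_derivation D \<Longrightarrow> D (f - g) = D f - D g"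
  using der_add[of D "f - g" g] by simp

lemma der_const_poly:
  assumes "is_derivation D"
  shows "D [:p:] = [:pderiv p:] * D bX"
proof (induction p)
  case 0
  then show ?case using assms by (simp add: der_0)
next
  case (pCons c p)
  have "[:pCons c p:] = bconst c + bX * [:p:]"
    by (simp add: bconst_def bX_def)
  then have "D [:pCons c p:] = [:p:] * D bX + bX * D [:p:]"
    using assms by (simp only: der_add der_mult der_const) simp
  moreover have "[:pderiv (pCons c p):] = [:p:] + bX * [:pderiv p:]"
    by (simp add: bX_def pderiv_pCons)
  ultimately show ?case using pCons by (simp only: distrib_right mult.assoc)
qed

lemma simple_der: "simple_derivation D \<Longrightarrow> is_derivation D"
  by (simp add: simple_derivation_def)

lemma simple_stable_ideal:
  assumes "simple_derivation D" "is_ideal I" "D ` I \<subseteq> I" "f \<in> I" "f \<noteq> 0"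
  shows "1 \<in> I"
  using assms unfolding simple_derivation_def by (metis UNIV_I singletonD)

text \<open>The Leibniz rule makes the principal ideal of \<open>f\<close> stable, so the only
  Darboux polynomials of a simple derivation are units.\<close>

lemma simple_semi_invariant:
  assumes "simple_derivation D" "f dvd D f" "f \<noteq> 0"
  shows "f dvd 1"
proof -
  have "is_ideal {h. f dvd h}"
    by (auto simp: is_ideal_def)
  moreover have "D ` {h. f dvd h} \<subseteq> {h. f dvd h}"
  proof safe
    fix h assume "f dvd h"
    then obtain g where "h = f * g" ..
    then show "f dvd D h" using assms(2) by (simp add: der_mult[OF simple_der[OF assms(1)]])
  qed
  ultimately have "1 \<in> {h. f dvd h}"
    by (rule simple_stable_ideal[OF assms(1)]) (use assms in auto)
  then show ?thesis by simp
qed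

lemma ex_antiderivative:
  fixes p :: "'a::field_char_0 poly"
  shows "\<exists>q. pderiv q = p"
proof
  have "pderiv (sum f A) = (\<Sum>i\<in>A. pderiv (f i))" for f :: "nat \<Rightarrow> 'a poly" and A
    by (induction A rule: infinite_finite_induct) (auto simp: pderiv_add)
  moreover have "of_nat (Suc i) * (c / of_nat (Suc i)) = c" for i and c :: 'a
    by (simp del: of_nat_Suc)
  ultimately show "pderiv (\<Sum>i\<le>degree p. monom (coeff p i / of_nat (Suc i)) (Suc i)) = p"
    by (simp add: pderiv_monom poly_as_sum_of_monoms del: of_nat_Suc)
qed

text \<open>In each case a nonunit divides its own image: \<open>a\<close> itself if it is not
  constant, because its image is a' a; x if \<open>a = 0\<close>; and y - q(x) with q' = b / c if
  \<open>a\<close> is a constant \<open>c \<noteq> 0\<close>, because \<open>D\<close> kills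
  it.\<close>

lemma simple_not_univariate:
  fixes D :: "'a::field_char_0 bipoly \<Rightarrow> 'a bipoly"
  assumes D: "simple_derivation D" and X: "D bX = [:a:]" and Y: "D bY = [:b:]"
  shows False
proof (cases "degree a = 0")
  case False
  have "D [:a:] = [:pderiv a:] * [:a:]"
    using der_const_poly[OF simple_der[OF D]] X by simp
  then have "[:a:] dvd D [:a:]" by simp
  then have "[:a:] dvd 1"
    by (rule simple_semi_invariant[OF D]) (use False in auto)
  then show False
    using False is_unit_iff_degree[of a] by (cases "a = 0") (auto simp: is_unit_const_poly_iff)
next
  case True
  then obtain c where c: "a = [:c:]" by (rule degree_eq_zeroE)
  show False
  proof (cases "c = 0")
    case True
    have "bX dvd D bX" using X True c by simp
    then have "(bX :: 'a bipoly) dvd 1"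
      by (rule simple_semi_invariant[OF D]) (simp add: bX_def)
    then show False by (auto simp: bX_def is_unit_const_poly_iff is_unit_pCons_iff)
  next
    case False
    obtain q where q: "pderiv q = smult (1 / c) b" using ex_antiderivative by blast
    have "D (bY - [:q:]) = 0"
      using X Y q c False by (simp add: der_diff[OF simple_der[OF D]] der_const_poly[OF simple_der[OF D]])
    then have "bY - [:q:] dvd D (bY - [:q:])" by simp
    then have "bY - [:q:] dvd 1"
      by (rule simple_semi_invariant[OF D]) (simp add: bY_def)
    then show False by (auto simp: bY_def is_unit_poly_iff)
  qed
qed

text \<open>The ideal generated by the differences \<open>\<sigma> h - \<tau> h\<close> is stable under \<open>D\<close>.
  For \<open>\<tau> = id\<close> it is the ideal of the fixed points of \<open>\<sigma>\<close>.\<close>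
lemma simple_coincidence:
  assumes D: "simple_derivation D" and h: "alg_hom \<sigma>" "alg_hom \<tau>" and ne: "\<sigma> \<noteq> \<tau>"
    and \<sigma>: "\<And>f. D (\<sigma> f) = \<sigma> (E f)" and \<tau>: "\<And>f. D (\<tau> f) = \<tau> (E f)"
  shows "\<exists>u v. u * (\<sigma> bX - \<tau> bX) + v * (\<sigma> bY - \<tau> bY) = 1"
proof -
  define I where "I = {u * (\<sigma> bX - \<tau> bX) + v * (\<sigma> bY - \<tau> bY) | u v. True}"
  have I0: "0 \<in> I"
    unfolding I_def by (rule CollectI, rule exI[of _ 0], rule exI[of _ 0]) simp
  have Iadd: "a + b \<in> I" if "a \<in> I" "b \<in> I" for a b
  proof -
    from that obtain u v u' v' where
      "a = u * (\<sigma> bX - \<tau> bX) + v * (\<sigma> bY - \<tau> bY)" "b = u' * (\<sigma> bX - \<tau> bX) + v' * (\<sigma> bY - \<tau> bY)"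
      by (auto simp: I_def)
    then have "a + b = (u + u') * (\<sigma> bX - \<tau> bX) + (v + v') * (\<sigma> bY - \<tau> bY)"
      by (simp add: distrib_right add_ac)
    then show ?thesis unfolding I_def by blast
  qed
  have Imult: "r * a \<in> I" if "a \<in> I" for r a
  proof -
    from that obtain u v where "a = u * (\<sigma> bX - \<tau> bX) + v * (\<sigma> bY - \<tau> bY)"
      by (auto simp: I_def)
    then have "r * a = (r * u) * (\<sigma> bX - \<tau> bX) + (r * v) * (\<sigma> bY - \<tau> bY)"
      by (simp add: distrib_left mult.assoc)
    then show ?thesis unfolding I_def by blast
  qed
  have ideal: "is_ideal I" using I0 Iadd Imult by (auto simp: is_ideal_def)
  have IX: "\<sigma> bX - \<tau> bX \<in> I" unfolding I_def
    by (rule CollectI, rule exI[of _ 1], rule exI[of _ 0]) simp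
  have IY: "\<sigma> bY - \<tau> bY \<in> I" unfolding I_def
    by (rule CollectI, rule exI[of _ 0], rule exI[of _ 1]) simp
  have diff: "\<sigma> f - \<tau> f \<in> I" for f
  proof (induction f rule: bipoly_induct)
    case (const c)
    then show ?case using I0 h by (simp add: hom_const)
  next
    case (add f g)
    have "\<sigma> (f + g) - \<tau> (f + g) = (\<sigma> f - \<tau> f) + (\<sigma> g - \<tau> g)"
      using h by (simp add: hom_add)
    then show ?case using Iadd add by metis
  next
    case (mult f g)
    have "\<sigma> (f * g) - \<tau> (f * g) = \<sigma> g * (\<sigma> f - \<tau> f) + \<tau> f * (\<sigma> g - \<tau> g)"
      using h by (simp add: hom_mult algebra_simps)
    then show ?case using Iadd Imult mult by metis
  qed (use IX IY in auto)
  have "D (\<sigma> f - \<tau> f) \<in> I" for f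
    using diff[of "E f"] by (simp add: der_diff[OF simple_der[OF D]] \<sigma> \<tau>)
  then have DX: "D (\<sigma> bX - \<tau> bX) \<in> I" and DY: "D (\<sigma> bY - \<tau> bY) \<in> I" by auto
  have "D ` I \<subseteq> I"
  proof safe
    fix a assume "a \<in> I"
    then obtain u v where "a = u * (\<sigma> bX - \<tau> bX) + v * (\<sigma> bY - \<tau> bY)"
      by (auto simp: I_def)
    then have "D a = (D u * (\<sigma> bX - \<tau> bX) + D v * (\<sigma> bY - \<tau> bY))
        + (u * D (\<sigma> bX - \<tau> bX) + v * D (\<sigma> bY - \<tau> bY))"
      by (simp only: der_add[OF simple_der[OF D]] der_mult[OF simple_der[OF D]]) (simp add: mult_ac add_ac)
    then show "D a \<in> I" using IX IY DX DY Iadd Imult by metis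
  qed
  moreover obtain f where "\<sigma> f - \<tau> f \<noteq> 0" using ne by auto
  ultimately have "1 \<in> I"
    using simple_stable_ideal[OF D ideal] diff by blast
  then obtain u v where "1 = u * (\<sigma> bX - \<tau> bX) + v * (\<sigma> bY - \<tau> bY)"
    unfolding I_def by blast
  then show ?thesis by metis
qed

lemma simple_conj:
  assumes D: "simple_derivation D" and \<kappa>: "is_K_algebra_aut \<kappa>"
  shows "simple_derivation (inv \<kappa> \<circ> D \<circ> \<kappa>)"
proof -
  note h = aut_hom[OF \<kappa>] and hi = hom_inv[OF \<kappa>]
    and inv[simp] = aut_inv_left_apply[OF \<kappa>] aut_inv_right_apply[OF \<kappa>]
  note d = simple_der[OF D]
  have "is_derivation (inv \<kappa> \<circ> D \<circ> \<kappa>)"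
    unfolding is_derivation_def comp_def
    by (simp only: hom_simps[OF h] hom_simps[OF hi] der_add[OF d] der_const[OF d] der_mult[OF d] inv) simp
  moreover have "I = {0} \<or> I = UNIV" if I: "is_ideal I" "(inv \<kappa> \<circ> D \<circ> \<kappa>) ` I \<subseteq> I" for I
  proof (rule ccontr)
    assume contr: "\<not> (I = {0} \<or> I = UNIV)"
    have inI: "\<kappa> a \<in> \<kappa> ` I \<longleftrightarrow> a \<in> I" for a
      by (metis image_iff inv(1))
    have mem: "b \<in> \<kappa> ` I \<longleftrightarrow> inv \<kappa> b \<in> I" for b
      using inI[of "inv \<kappa> b"] by simp
    have "is_ideal (\<kappa> ` I)"
      using I(1) unfolding is_ideal_def by (auto simp: mem hom_simps[OF hi])
    moreover have "D ` \<kappa> ` I \<subseteq> \<kappa> ` I"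
      using I(2) by (auto simp: mem)
    moreover obtain f where "f \<in> I" "f \<noteq> 0"
      using contr I(1) by (auto simp: is_ideal_def)
    moreover from this have "\<kappa> f \<noteq> 0" by (metis inv(1) hom_0[OF hi])
    ultimately have "1 \<in> \<kappa> ` I"
      using simple_stable_ideal[OF D] by blast
    then have "1 \<in> I" by (simp add: mem hom_1[OF hi])
    then have "x \<in> I" for x using I(1) unfolding is_ideal_def by (metis mult.right_neutral)
    then show False using contr by auto
  qed
  ultimately show ?thesis by (auto simp: simple_derivation_def)
qed

lemma conj_commute:
  assumes \<kappa>: "is_K_algebra_aut \<kappa>" and c: "\<kappa> \<circ> \<rho>' = \<rho> \<circ> \<kappa>" and D: "\<rho> \<circ> D = D \<circ> \<rho>"
  shows "\<rho>' \<circ> (inv \<kappa> \<circ> D \<circ> \<kappa>) = (inv \<kappa> \<circ> D \<circ> \<kappa>) \<circ> \<rho>'"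
proof
  fix f
  note inv[simp] = aut_inv_left_apply[OF \<kappa>] aut_inv_right_apply[OF \<kappa>]
  have c': "\<kappa> (\<rho>' g) = \<rho> (\<kappa> g)" for g using c by (metis comp_apply)
  have "\<kappa> (\<rho>' (inv \<kappa> (D (\<kappa> f)))) = D (\<kappa> (\<rho>' f))"
    using c' D by (simp add: fun_eq_iff)
  then show "(\<rho>' \<circ> (inv \<kappa> \<circ> D \<circ> \<kappa>)) f = ((inv \<kappa> \<circ> D \<circ> \<kappa>) \<circ> \<rho>') f"
    by (metis comp_apply inv(1))
qed

section \<open>Triangular automorphisms\<close>

lemma hom_pCons: "alg_hom \<rho> \<Longrightarrow> \<rho> (pCons p f) = \<rho> [:p:] + \<rho> bY * \<rho> f"
  using hom_add[of \<rho> "[:p:]" "bY * f"] hom_mult[of \<rho> bY f] by (simp add: bY_def)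

lemma hom_const_pCons: "alg_hom \<rho> \<Longrightarrow> \<rho> [:pCons c p:] = bconst c + \<rho> bX * \<rho> [:p:]"
  using hom_add[of \<rho> "bconst c" "bX * [:p:]"] hom_mult[of \<rho> bX "[:p:]"] hom_const[of \<rho> c]
  by (simp add: bX_def bconst_def)

lemma bswap_const_poly: "bswap [:p:] = map_poly (\<lambda>c. [:c:]) p"
proof (induction p)
  case 0
  then show ?case by (simp add: hom_0[OF hom_bswap])
next
  case (pCons c p)
  then show ?case
    by (simp add: hom_const_pCons[OF hom_bswap] map_poly_pCons) (simp add: bconst_def bY_def)
qed

lemma coeff_bswap: "coeff (coeff (bswap f) j) i = coeff (coeff f i) j"
proof (induction f arbitrary: i)
  case 0
  then show ?case by (simp add: hom_0[OF hom_bswap])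
next
  case (pCons p f)
  have "coeff (bX * g) j = pCons 0 (coeff g j)" for g :: "'a bipoly"
    by (simp add: bX_def)
  then show ?case using pCons
    by (simp add: hom_pCons[OF hom_bswap, of p f] bswap_const_poly coeff_map_poly coeff_pCons split: nat.splits)
qed

section \<open>Translations and difference equations in one variable\<close>

text \<open>The value of \<open>q\<close> at 0 is repeated at all multiples of \<open>g\<close>, and
  in characteristic zero these are infinitely many. The coefficients need only form a domain, since
  a translation of y has coefficients in K[x].\<close>

lemma shift_invariant_imp_const:
  fixes q :: "'a::{idom,ring_char_0} poly"
  assumes q: "pcompose q [:g, 1:] = q" and g: "g \<noteq> 0"
  shows "degree q = 0"
proof -
  have shift: "poly q (g + x) = poly q x" for x
    by (subst q[symmetric]) (simp add: poly_pcompose)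
  have "poly q (of_nat n * g) = poly q 0" for n
  proof (induction n)
    case (Suc n)
    then show ?case using shift[of "of_nat n * g"] by (simp add: algebra_simps)
  qed simp
  then have "range (\<lambda>n. of_nat n * g) \<subseteq> {x. poly (q - [:poly q 0:]) x = 0}" by auto
  moreover have "infinite (range (\<lambda>n. of_nat n * g))"
    using g by (intro range_inj_infinite) (auto simp: inj_on_def)
  ultimately have "q - [:poly q 0:] = 0"
    using poly_roots_finite finite_subset by blast
  then show ?thesis by (metis degree_pCons_0 eq_iff_diff_eq_0)
qed

lemma scaled_shift_invariant_imp_const:
  fixes q :: "'a::{idom,ring_char_0} poly"
  assumes q: "smult c (pcompose q [:g, 1:]) = q" and g: "g \<noteq> 0"
  shows "degree q = 0"
proof (cases "q = 0")
  case False
  have "c * lead_coeff q = lead_coeff q"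
  proof -
    have "lead_coeff (smult c (pcompose q [:g, 1:])) = c * lead_coeff q"
      unfolding lead_coeff_smult by (subst lead_coeff_comp) auto
    then show ?thesis using q by metis
  qed
  then have "c = 1" using False by simp
  then show ?thesis using q g by (intro shift_invariant_imp_const[of q g]) auto
qed auto

text \<open>The operator keeps the degree if \<open>d \<noteq> 1\<close> and lowers it by one on
  nonconstant polynomials if \<open>d = 1\<close>. So it reaches a polynomial with top coefficient 1
  in every degree, and \<open>p\<close> is exhausted from its top coefficient downward.\<close>

lemma ex_difference_equation:
  fixes p :: "'a::field_char_0 poly"
  assumes g: "g \<noteq> 0"
  shows "\<exists>s. pcompose s [:g, 1:] - smult d s = p"
proof -
  define \<Delta> where "\<Delta> s = pcompose s [:g, 1:] - smult d s" for s
  have \<Delta>_add: "\<Delta> (s + t) = \<Delta> s + \<Delta> t" for s t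
    by (simp add: \<Delta>_def pcompose_add smult_add_right)
  have monom: "pcompose (monom a k) [:g, 1:] = smult a ([:g, 1:] ^ k)" for a k
    by (induction k) (auto simp: monom_0 monom_Suc pcompose_pCons)
  have deg_lin: "degree ([:g, 1:] ^ k) = k" for k
    by (simp add: degree_power_eq)
  have step: "\<exists>s. degree (\<Delta> s) \<le> n \<and> coeff (\<Delta> s) n = 1" for n
  proof (cases "d = 1")
    case False
    have "degree (\<Delta> (monom (1 / (1 - d)) n)) \<le> n"
      unfolding \<Delta>_def monom
      by (intro degree_diff_le) (auto intro: order.trans[OF degree_smult_le] simp: deg_lin degree_monom_le)
    moreover have "coeff (\<Delta> (monom (1 / (1 - d)) n)) n = 1"
      using False unfolding \<Delta>_def monom by (simp add: coeff_linear_power field_simps)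
    ultimately show ?thesis by blast
  next
    case True
    \<comment> \<open>The difference of x^(n+1) and its translate has top term (n + 1) g x^n, which
      the factor normalises.\<close>
    define s where "s = monom (1 / (of_nat (Suc n) * g)) (Suc n)"
    have "coeff (\<Delta> s) i = 0" if "i > n" for i
    proof (cases "i = Suc n")
      case True
      then show ?thesis using \<open>d = 1\<close> unfolding \<Delta>_def s_def monom by (simp add: coeff_linear_power del: power_Suc of_nat_Suc)
    next
      case False
      then show ?thesis using that deg_lin[of "Suc n"] unfolding \<Delta>_def s_def monom
        by (simp add: coeff_eq_0 del: power_Suc)
    qed
    then have "degree (\<Delta> s) \<le> n" by (intro degree_le) auto
    moreover have "coeff (\<Delta> s) n = 1"
      using g unfolding \<Delta>_def s_def monom
      by (simp add: coeff_linear_poly_power del: power_Suc of_nat_Suc)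
    ultimately show ?thesis by blast
  qed
  have "\<exists>s. \<Delta> s = p" if "\<And>i. i \<ge> n \<Longrightarrow> coeff p i = 0" for n p
    using that
  proof (induction n arbitrary: p)
    case 0
    then have "p = 0" by (intro poly_eqI) auto
    then show ?case by (intro exI[of _ 0]) (simp add: \<Delta>_def)
  next
    case (Suc n)
    obtain s where s: "degree (\<Delta> s) \<le> n" "coeff (\<Delta> s) n = 1" using step by blast
    have sm: "\<Delta> (smult (coeff p n) s) = smult (coeff p n) (\<Delta> s)"
      by (simp add: \<Delta>_def pcompose_smult smult_diff_right mult.commute)
    have "coeff (p - \<Delta> (smult (coeff p n) s)) i = 0" if "i \<ge> n" for i
      using s Suc.prems[of i] that by (cases "i = n") (auto simp: sm coeff_eq_0)
    then obtain t where "\<Delta> t = p - \<Delta> (smult (coeff p n) s)" using Suc.IH by blast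
    then have "\<Delta> (t + smult (coeff p n) s) = p" by (simp add: \<Delta>_add)
    then show ?case by blast
  qed
  from this[of "Suc (degree p)" p] show ?thesis by (auto simp: \<Delta>_def coeff_eq_0)
qed

text \<open>These are the de Jonquieres automorphisms; nonzero \<open>\<alpha>\<close> and
  \<open>\<delta>\<close> make them invertible.\<close>

definition triangular :: "('a::field bipoly \<Rightarrow> 'a bipoly) \<Rightarrow> bool" where
  "triangular \<beta> \<longleftrightarrow> alg_hom \<beta> \<and> (\<exists>\<alpha> \<gamma> \<delta> p. \<alpha> \<noteq> 0 \<and> \<delta> \<noteq> 0 \<and>
     \<beta> bX = bconst \<alpha> * bX + bconst \<gamma> \<and> \<beta> bY = bconst \<delta> * bY + [:p:])"

lemma triangularI:
  assumes "alg_hom \<beta>" "\<alpha> \<noteq> 0" "\<delta> \<noteq> 0" "\<beta> bX = bconst \<alpha> * bX + bconst \<gamma>" "\<beta> bY = bconst \<delta> * bY + [:p:]"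
  shows "triangular \<beta>"
  using assms by (auto simp: triangular_def)

lemma triangular_hom: "triangular \<beta> \<Longrightarrow> alg_hom \<beta>"
  by (simp add: triangular_def)

lemma affine_X: "bconst \<alpha> * bX + bconst \<gamma> = [:[:\<gamma>, \<alpha>:]:]"
  by (simp add: bconst_def bX_def)

lemma hom_const_poly_affine:
  "alg_hom \<beta> \<Longrightarrow> \<beta> bX = bconst \<alpha> * bX + bconst \<gamma> \<Longrightarrow> \<beta> [:p:] = [:pcompose p [:\<gamma>, \<alpha>:]:]"
  by (rule const_poly_as_hom) (simp_all add: affine_X)

lemma aut_triangular:
  assumes "triangular \<beta>"
  shows "is_K_algebra_aut \<beta>"
proof -
  from assms obtain \<alpha> \<gamma> \<delta> p where h: "alg_hom \<beta>" and nz: "\<alpha> \<noteq> 0" "\<delta> \<noteq> 0"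
    and X: "\<beta> bX = bconst \<alpha> * bX + bconst \<gamma>" and Y: "\<beta> bY = bconst \<delta> * bY + [:p:]"
    by (auto simp: triangular_def)
  define X' where "X' = bconst (1 / \<alpha>) * bX + bconst (- \<gamma> / \<alpha>)"
  define Y' where "Y' = bconst (1 / \<delta>) * (bY - [:pcompose p [:- \<gamma> / \<alpha>, 1 / \<alpha>:]:])"
  have c1: "bconst (1 / \<alpha>) * bconst \<alpha> = 1" "bconst (1 / \<delta>) * bconst \<delta> = 1"
    using nz by (simp_all add: bconst_1 flip: bconst_mult)
  have comp: "pcompose (pcompose p [:- \<gamma> / \<alpha>, 1 / \<alpha>:]) [:\<gamma>, \<alpha>:] = p"
    using nz by (simp add: pcompose_pCons field_simps flip: pcompose_assoc)
  have "\<beta> X' = bX"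
    unfolding X'_def hom_simps[OF h] X
    using nz by (simp add: bconst_def bX_def)
  moreover have "\<beta> Y' = bY"
    unfolding Y'_def hom_simps[OF h] Y hom_const_poly_affine[OF h X] comp
    using c1 by (simp add: mult.assoc[symmetric])
  moreover have "bsubst X' Y' (\<beta> bX) = bX"
    unfolding X hom_simps[OF hom_bsubst] bsubst_X X'_def
    using nz by (simp add: bconst_def bX_def)
  moreover have "bsubst X' Y' (\<beta> bY) = bY"
  proof -
    have "bsubst X' Y' [:p:] = [:pcompose p [:- \<gamma> / \<alpha>, 1 / \<alpha>:]:]"
      by (rule hom_const_poly_affine[OF hom_bsubst]) (simp add: X'_def)
    then show ?thesis
      unfolding Y hom_simps[OF hom_bsubst] bsubst_Y Y'_def
      using c1 by (simp add: mult.assoc[symmetric] mult.commute[of "bconst \<delta>"])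
  qed
  ultimately have "is_K_algebra_aut (bsubst (\<beta> bX) (\<beta> bY))"
    using hom_eq_bsubst[OF h] by (metis aut_bsubstI)
  then show ?thesis using hom_eq_bsubst[OF h] by simp
qed

lemma triangular_id: "triangular id"
  by (rule triangularI[where \<alpha> = 1 and \<gamma> = 0 and \<delta> = 1 and p = 0]) (simp_all add: hom_id bconst_1 bconst_0)

lemma triangular_comp:
  assumes "triangular \<beta>" "triangular \<beta>'"
  shows "triangular (\<beta> \<circ> \<beta>')"
proof -
  from assms(1) obtain \<alpha> \<gamma> \<delta> p where h: "alg_hom \<beta>" and nz: "\<alpha> \<noteq> 0" "\<delta> \<noteq> 0"
    and X: "\<beta> bX = bconst \<alpha> * bX + bconst \<gamma>" and Y: "\<beta> bY = bconst \<delta> * bY + [:p:]"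
    by (auto simp: triangular_def)
  from assms(2) obtain \<alpha>' \<gamma>' \<delta>' p' where h': "alg_hom \<beta>'" and nz': "\<alpha>' \<noteq> 0" "\<delta>' \<noteq> 0"
    and X': "\<beta>' bX = bconst \<alpha>' * bX + bconst \<gamma>'" and Y': "\<beta>' bY = bconst \<delta>' * bY + [:p':]"
    by (auto simp: triangular_def)
  have "\<beta> (\<beta>' bX) = bconst (\<alpha>' * \<alpha>) * bX + bconst (\<alpha>' * \<gamma> + \<gamma>')"
    unfolding X' hom_simps[OF h] X by (simp add: algebra_simps bconst_mult bconst_add)
  moreover have "\<beta> (\<beta>' bY) = bconst (\<delta>' * \<delta>) * bY + [:smult \<delta>' p + pcompose p' [:\<gamma>, \<alpha>:]:]"
    unfolding Y' hom_simps[OF h] Y hom_const_poly_affine[OF h X]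
    by (simp add: algebra_simps bconst_mult) (simp add: bconst_def)
  ultimately show ?thesis
    using nz nz' hom_comp[OF h h'] by (intro triangularI[of _ "\<alpha>' * \<alpha>" "\<delta>' * \<delta>"]) simp_all
qed

text \<open>At a fixed point the generators of the coincidence ideal of \<open>\<rho>\<close> and
  \<open>id\<close> vanish, so no combination of them is 1.\<close>

lemma simple_fixed_point:
  assumes D: "simple_derivation D" and comm: "\<rho> \<circ> D = D \<circ> \<rho>" and h: "alg_hom \<rho>"
    and X: "poly (poly (\<rho> bX) [:y:]) x = x" and Y: "poly (poly (\<rho> bY) [:y:]) x = y"
  shows "\<rho> = id"
proof (rule ccontr)
  assume "\<rho> \<noteq> id"
  then obtain u v where "u * (\<rho> bX - id bX) + v * (\<rho> bY - id bY) = 1"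
    using simple_coincidence[OF D h hom_id, of D] comm by (auto simp: fun_eq_iff)
  then have "poly (poly (u * (\<rho> bX - id bX) + v * (\<rho> bY - id bY)) [:y:]) x = 1" by simp
  then show False by (simp add: X Y) (simp add: bX_def bY_def)
qed

lemma simple_triangular:
  fixes D :: "'a::field_char_0 bipoly \<Rightarrow> 'a bipoly"
  assumes D: "simple_derivation D" and comm: "\<beta> \<circ> D = D \<circ> \<beta>" and tri: "triangular \<beta>"
  shows "\<beta> = id"
proof (rule ccontr)
  assume ne: "\<beta> \<noteq> id"
  from tri obtain \<alpha> \<gamma> \<delta> p where h: "alg_hom \<beta>" and nz: "\<alpha> \<noteq> 0" "\<delta> \<noteq> 0"
    and X: "\<beta> bX = bconst \<alpha> * bX + bconst \<gamma>" and Y: "\<beta> bY = bconst \<delta> * bY + [:p:]"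
    by (auto simp: triangular_def)
  have comm': "\<beta> (D f) = D (\<beta> f)" for f using comm by (metis comp_apply)
  have no_fixed: False if "\<alpha> * x + \<gamma> = x" "\<delta> * y + poly p x = y" for x y
  proof -
    have "\<beta> = id"
      by (rule simple_fixed_point[OF D comm h, where x = x and y = y])
         (unfold X Y, use that in \<open>simp_all add: bX_def bY_def bconst_def algebra_simps\<close>)
    then show False using ne by simp
  qed
  consider "\<alpha> \<noteq> 1" | "\<alpha> = 1" "\<gamma> \<noteq> 0" | "\<alpha> = 1" "\<gamma> = 0" by blast
  then show False
  proof cases
    case 1
    \<comment> \<open>The fixed point of the action on the first coordinate; the vertical line over
      it is invariant.\<close>
    define x where "x = \<gamma> / (1 - \<alpha>)"
    have x: "\<alpha> * x + \<gamma> = x" using 1 by (simp add: x_def field_simps)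
    have \<delta>: "\<delta> = 1"
    proof (rule ccontr)
      assume "\<delta> \<noteq> 1"
      then have "\<delta> * (poly p x / (1 - \<delta>)) + poly p x = poly p x / (1 - \<delta>)"
        by (simp add: field_simps)
      then show False using no_fixed x by blast
    qed
    \<comment> \<open>Restriction to the invariant line, as a polynomial in y; the swap makes x the
      outer variable, which is then evaluated.\<close>
    define e where "e f = poly (bswap f) [:x:]" for f :: "'a bipoly"
    have e_simps: "e (f + g) = e f + e g" "e (f * g) = e f * e g" "e (bconst c) = [:c:]"
      "e bX = [:x:]" "e bY = [:0, 1:]" for f g c
      by (simp_all add: e_def hom_simps[OF hom_bswap]) (simp_all add: bconst_def bX_def bY_def)
    have e_poly: "e [:q:] = [:poly q x:]" for q
      unfolding e_def bswap_const_poly by (induction q) (auto simp: map_poly_pCons)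
    have e_\<beta>: "e (\<beta> f) = pcompose (e f) [:poly p x, 1:]" for f
    proof (induction f rule: bipoly_induct)
      case X
      then show ?case using x by (simp add: \<open>\<beta> bX = _\<close> e_simps mult.commute)
    next
      case Y
      then show ?case using \<delta> by (simp add: \<open>\<beta> bY = _\<close> e_simps e_poly pcompose_pCons)
    qed (simp_all add: hom_simps[OF h] e_simps pcompose_add pcompose_mult)
    \<comment> \<open>On the line \<open>\<beta>\<close> acts as a translation of y, which preserves
      leading coefficients and so has no eigenvalue other than 1.\<close>
    have eigen: "e f = 0" if "\<beta> f = bconst \<alpha> * f" for f
    proof (rule ccontr)
      assume "e f \<noteq> 0"
      have "pcompose (e f) [:poly p x, 1:] = smult \<alpha> (e f)"
        using e_\<beta>[of f] that by (simp add: e_simps)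
      moreover have "lead_coeff (pcompose (e f) [:poly p x, 1:]) = lead_coeff (e f)"
        by (subst lead_coeff_comp) auto
      ultimately have "lead_coeff (e f) = \<alpha> * lead_coeff (e f)"
        by (metis lead_coeff_smult)
      then show False using \<open>e f \<noteq> 0\<close> 1 by simp
    qed
    \<comment> \<open>\<open>J\<close> is the largest \<open>D\<close>-stable ideal inside the ideal of the invariant line.\<close>
    define J where "J = {f. \<forall>k. e ((D ^^ k) f) = 0}"
    have d: "is_derivation D" by (rule simple_der[OF D])
    have Dadd: "(D ^^ k) (f + g) = (D ^^ k) f + (D ^^ k) g" for k f g
      by (induction k) (auto simp: der_add[OF d])
    have DJ: "D f \<in> J" if "f \<in> J" for f
    proof -
      have "(D ^^ k) (D f) = (D ^^ Suc k) f" for k by (simp add: funpow_swap1)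
      then show ?thesis using that unfolding J_def by (simp only: mem_Collect_eq) simp
    qed
    \<comment> \<open>The quantifiers over \<open>r\<close> and \<open>f\<close> stay inside the
      induction because the Leibniz rule replaces the pair (r, f) by (D r, f) and (r, D f).\<close>
    have mult: "\<forall>r f. f \<in> J \<longrightarrow> e ((D ^^ k) (r * f)) = 0" for k
    proof (induction k)
      case 0
      then show ?case unfolding J_def by (auto simp: e_simps dest!: spec[of _ 0])
    next
      case (Suc k)
      have "(D ^^ Suc k) (r * f) = (D ^^ k) (D r * f) + (D ^^ k) (r * D f)" for r f
        by (simp add: funpow_swap1 der_mult[OF d] Dadd mult.commute)
      then show ?case using Suc DJ by (simp add: e_simps)
    qed
    have "is_ideal J"
      unfolding is_ideal_def
    proof (intro conjI ballI allI)
      have "(D ^^ k) 0 = 0" for k by (induction k) (auto simp: der_0[OF d])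
      then show "0 \<in> J" by (simp add: J_def e_def hom_0[OF hom_bswap])
      show "f + g \<in> J" if "f \<in> J" "g \<in> J" for f g using that by (simp add: J_def Dadd e_simps)
      show "r * f \<in> J" if "f \<in> J" for r f using mult that by (simp add: J_def)
    qed
    moreover have "D ` J \<subseteq> J" using DJ by auto
    \<comment> \<open>The equation of the line is an eigenvector of \<open>\<beta>\<close> for
      \<open>\<alpha> \<noteq> 1\<close>. Its iterated images under \<open>D\<close> are too, so
      their restrictions to the line vanish.\<close>
    moreover have "bX - bconst x \<in> J"
    proof -
      have \<beta>k: "\<beta> ((D ^^ k) (bX - bconst x)) = bconst \<alpha> * (D ^^ k) (bX - bconst x)" for k
      proof (induction k)
        case 0
        have "bconst \<gamma> = bconst x - bconst \<alpha> * bconst x"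
          using x by (simp flip: bconst_mult bconst_diff) (simp add: eq_diff_eq add.commute)
        then show ?case by (simp add: hom_simps[OF h] X algebra_simps)
      next
        case (Suc k)
        then show ?case by (simp add: comm' der_scale[OF d])
      qed
      show ?thesis unfolding J_def using eigen[OF \<beta>k] by simp
    qed
    moreover have "bX - bconst x \<noteq> 0" by (simp add: bX_def bconst_def)
    ultimately have "1 \<in> J" by (rule simple_stable_ideal[OF D])
    then have "e 1 = 0" unfolding J_def by (auto dest!: spec[of _ 0])
    then show False using e_simps(3)[of 1] by (simp add: bconst_1)
  next
    case 2
    \<comment> \<open>Conjugation by the shear y + s(x) then removes \<open>p\<close> and leaves the
      diagonal scaling of y with the translation of x.\<close>
    obtain s where s: "pcompose s [:\<gamma>, 1:] - smult \<delta> s = - p"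
      using ex_difference_equation[OF 2(2)] by blast
    define \<kappa> where "\<kappa> = bsubst bX (bY + [:s:])"
    define \<beta>' where "\<beta>' = bsubst (bX + bconst \<gamma>) (bconst \<delta> * bY)"
    have h\<kappa>: "alg_hom \<kappa>" and h': "alg_hom \<beta>'" by (simp_all add: \<kappa>_def \<beta>'_def hom_bsubst)
    have \<kappa>: "is_K_algebra_aut \<kappa>"
    proof (rule aut_triangular)
      have "\<kappa> bX = bconst 1 * bX + bconst 0" "\<kappa> bY = bconst 1 * bY + [:s:]"
        by (simp_all add: \<kappa>_def bconst_0 bconst_1)
      then show "triangular \<kappa>" by (intro triangularI[OF h\<kappa>]) simp_all
    qed
    have conj: "\<kappa> \<circ> \<beta>' = \<beta> \<circ> \<kappa>"
    proof (rule hom_eqI)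
      show "(\<kappa> \<circ> \<beta>') bX = (\<beta> \<circ> \<kappa>) bX"
        using 2 by (simp add: \<beta>'_def hom_simps[OF h\<kappa>]) (simp add: \<kappa>_def X bconst_1)
      have "pcompose s [:\<gamma>, 1:] = smult \<delta> s - p" using s by (simp add: algebra_simps)
      then have "\<beta> [:s:] = [:smult \<delta> s - p:]"
        using hom_const_poly_affine[OF h X, of s] 2 by simp
      then show "(\<kappa> \<circ> \<beta>') bY = (\<beta> \<circ> \<kappa>) bY"
        by (simp add: \<beta>'_def hom_simps[OF h\<kappa>])
           (simp add: \<kappa>_def Y hom_simps[OF h] algebra_simps, simp add: bconst_def)
    qed (auto intro: hom_comp h h\<kappa> h')
    define E where "E = inv \<kappa> \<circ> D \<circ> \<kappa>"
    have E: "simple_derivation E" unfolding E_def by (rule simple_conj[OF D \<kappa>])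
    have "\<beta>' \<circ> E = E \<circ> \<beta>'" unfolding E_def by (rule conj_commute[OF \<kappa> conj comm])
    then have E\<beta>: "\<beta>' (E f) = E (\<beta>' f)" for f by (metis comp_apply)
    have \<beta>'_coeff: "coeff (\<beta>' f) j = smult (\<delta> ^ j) (pcompose (coeff f j) [:\<gamma>, 1:])" for f j
    proof (induction f arbitrary: j)
      case 0
      then show ?case by (simp add: hom_0[OF h'])
    next
      case (pCons q f)
      have "\<beta>' [:q:] = [:pcompose q [:\<gamma>, 1:]:]"
        by (rule hom_const_poly_affine[OF h']) (simp add: \<beta>'_def bconst_1)
      then have "\<beta>' (pCons q f) = [:pcompose q [:\<gamma>, 1:]:] + bconst \<delta> * bY * \<beta>' f"
        by (simp add: hom_pCons[OF h', of q f]) (simp add: \<beta>'_def)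
      then show ?case using pCons by (cases j) (auto simp: bconst_def bY_def mult.commute)
    qed
    \<comment> \<open>An eigenvector of \<open>\<beta>'\<close> has coefficients in K[x] that are
      invariant under translation up to a scalar, hence constant; it is a polynomial in y alone.
      This will apply to \<open>E bX\<close> and \<open>E bY\<close>.\<close>
    have const: "coeff f j = [:coeff (coeff f j) 0:]" if "\<beta>' f = bconst c * f" "c \<noteq> 0" for f c j
    proof -
      have "smult (\<delta> ^ j) (pcompose (coeff f j) [:\<gamma>, 1:]) = smult c (coeff f j)"
        using \<beta>'_coeff[of f j] that(1) by (simp add: bconst_def)
      then have "smult (1 / c * \<delta> ^ j) (pcompose (coeff f j) [:\<gamma>, 1:]) = coeff f j"
        using that(2) by (metis (no_types, lifting) divide_self_if mult.commute smult_1_left smult_smult times_divide_eq_right mult_1_right)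
      then have "degree (coeff f j) = 0" using 2(2) scaled_shift_invariant_imp_const by blast
      then show ?thesis by (metis coeff_pCons_0 degree_eq_zeroE)
    qed
    have swap_const: "bswap f = [:map_poly (\<lambda>q. coeff q 0) f:]"
      if "\<And>j. coeff f j = [:coeff (coeff f j) 0:]" for f :: "'a bipoly"
    proof (intro poly_eqI)
      fix i j
      have "coeff (coeff f i) j = (if j = 0 then coeff (coeff f i) 0 else 0)"
        by (subst that) (auto simp: coeff_pCons split: nat.splits)
      then show "coeff (coeff (bswap f) j) i = coeff (coeff [:map_poly (\<lambda>q. coeff q 0) f:] j) i"
        by (auto simp: coeff_bswap coeff_map_poly coeff_pCons split: nat.splits)
    qed
    have "\<beta>' (E bX) = bconst 1 * E bX"
      by (simp add: E\<beta>) (simp add: \<beta>'_def der_add[OF simple_der[OF E]] der_const[OF simple_der[OF E]] bconst_1)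
    then have "bswap (E bX) = [:map_poly (\<lambda>q. coeff q 0) (E bX):]"
      using const[of "E bX" 1] by (intro swap_const) auto
    moreover have "\<beta>' (E bY) = bconst \<delta> * E bY"
      by (simp add: E\<beta>) (simp add: \<beta>'_def der_scale[OF simple_der[OF E]])
    then have "bswap (E bY) = [:map_poly (\<lambda>q. coeff q 0) (E bY):]"
      using const[of "E bY" \<delta>] nz by (intro swap_const) auto
    moreover have "inv bswap = (bswap :: 'a bipoly \<Rightarrow> 'a bipoly)"
      using inv_unique_comp bswap_comp_bswap by blast
    ultimately show False
      using simple_not_univariate[OF simple_conj[OF E aut_bswap]] by auto
  next
    case 3
    have \<delta>: "\<delta> = 1"
    proof (rule ccontr)
      assume "\<delta> \<noteq> 1"
      then have "\<delta> * (poly p 0 / (1 - \<delta>)) + poly p 0 = poly p 0 / (1 - \<delta>)"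
        by (simp add: field_simps)
      then show False using no_fixed[of 0 "poly p 0 / (1 - \<delta>)"] 3 by simp
    qed
    have X': "\<beta> bX = bX" and Y': "\<beta> bY = bY + [:p:]" using X Y 3 \<delta> by (simp_all add: bconst_0 bconst_1)
    \<comment> \<open>The two generators of the ideal of the fixed points are 0 and
      \<open>p\<close>, so \<open>p\<close> is a unit.\<close>
    obtain u v where "u * (\<beta> bX - id bX) + v * (\<beta> bY - id bY) = 1"
      using simple_coincidence[OF D h hom_id ne, of D] comm' by auto
    then have "[:p:] dvd 1" using X' Y' by (metis add_0 add_diff_cancel_left' diff_self dvd_triv_right id_apply mult_zero_right)
    then obtain c where c: "p = [:c:]" "c \<noteq> 0"
      unfolding is_unit_const_poly_iff is_unit_poly_iff by fastforce
    have \<beta>: "\<beta> f = pcompose f [:[:c:], 1:]" for f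
    proof (induction f)
      case 0
      then show ?case by (simp add: hom_0[OF h])
    next
      case (pCons q f)
      have "\<beta> [:q:] = [:q:]" using hom_const_poly_affine[OF h X, of q] 3 by simp
      then show ?case using pCons by (simp add: hom_pCons[OF h, of q f] pcompose_pCons Y' c) (simp add: bY_def)
    qed
    \<comment> \<open>Invariance under the translation of y by \<open>c\<close>, over the
      coefficient ring K[x].\<close>
    have const: "\<exists>a. f = [:a:]" if "\<beta> f = f" for f
    proof -
      have "degree f = 0"
        by (rule shift_invariant_imp_const[of f "[:c:]"]) (use that \<beta> c in auto)
      then show ?thesis by (metis degree_eq_zeroE)
    qed
    have "\<beta> (D bX) = D bX" using X' by (simp add: comm')
    moreover have "\<beta> (D bY) = D bY"
    proof -
      have "D [:p:] = 0" using der_const[OF simple_der[OF D], of c] c by (simp add: bconst_def)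
      then show ?thesis by (simp add: comm' Y' der_add[OF simple_der[OF D]])
    qed
    ultimately show False using const simple_not_univariate[OF D] by blast
  qed
qed

section \<open>Total degree and leading forms\<close>

text \<open>The substitution \<open>x = t, y = u t\<close>, with \<open>t\<close> as the outer and \<open>u\<close> as the inner variable,
  turns the total degree into the degree in \<open>t\<close>, and the leading form into the leading
  coefficient, dehomogenised to a polynomial in \<open>u\<close>.\<close>
definition thom :: "'a::field bipoly \<Rightarrow> 'a bipoly" where
  "thom = bsubst bY (bX * bY)"

definition tdeg :: "'a::field bipoly \<Rightarrow> nat" where
  "tdeg f = degree (thom f)"

lemma hom_thom: "alg_hom thom"
  by (simp add: thom_def hom_bsubst)

lemmas thom_simps = hom_simps[OF hom_thom]

lemma thom_X [simp]: "thom bX = bY" and thom_Y [simp]: "thom bY = bX * bY"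
  by (simp_all add: thom_def)

lemma thom_const_poly: "thom [:p:] = map_poly (\<lambda>c. [:c:]) p"
proof (induction p)
  case 0
  then show ?case by (simp add: thom_simps)
next
  case (pCons c p)
  then show ?case
    by (simp add: hom_const_pCons[OF hom_thom] map_poly_pCons) (simp add: bconst_def bY_def)
qed

lemma coeff_thom: "coeff (coeff (thom f) k) j = (if j \<le> k then coeff (coeff f j) (k - j) else 0)"
proof (induction f arbitrary: j k)
  case 0
  then show ?case by (simp add: thom_simps)
next
  case (pCons p f)
  have "coeff (bX * bY * g) k = (case k of 0 \<Rightarrow> 0 | Suc k' \<Rightarrow> pCons 0 (coeff g k'))" for g :: "'a bipoly"
    by (simp add: bX_def bY_def coeff_pCons split: nat.splits)
  then show ?case using pCons
    by (simp add: hom_pCons[OF hom_thom, of p f] thom_const_poly coeff_map_poly coeff_pCons split: nat.splits)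
qed

lemma coeff_eq_coeff_thom: "coeff (coeff f j) i = coeff (coeff (thom f) (i + j)) j"
  by (simp add: coeff_thom)

lemma thom_eq_0_iff [simp]: "thom f = 0 \<longleftrightarrow> f = 0"
proof
  assume "thom f = 0"
  then show "f = 0" by (intro poly_eqI) (simp add: coeff_eq_coeff_thom)
qed (simp add: thom_simps)

lemma tdeg_le_iff: "tdeg f \<le> n \<longleftrightarrow> (\<forall>i j. i + j > n \<longrightarrow> coeff (coeff f j) i = 0)"
proof
  assume "tdeg f \<le> n"
  then show "\<forall>i j. i + j > n \<longrightarrow> coeff (coeff f j) i = 0"
    unfolding tdeg_def by (auto simp: coeff_eq_coeff_thom coeff_eq_0)
next
  assume "\<forall>i j. i + j > n \<longrightarrow> coeff (coeff f j) i = 0"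
  then show "tdeg f \<le> n" unfolding tdeg_def
    by (intro degree_le) (auto intro!: poly_eqI simp: coeff_thom)
qed

lemma tdeg_eq_0_iff: "tdeg f = 0 \<longleftrightarrow> (\<exists>c. f = bconst c)"
proof
  assume "tdeg f = 0"
  then have z: "coeff (coeff f j) i = 0" if "i + j > 0" for i j
    using tdeg_le_iff[of f 0] that by auto
  have "f = bconst (coeff (coeff f 0) 0)"
    by (intro poly_eqI) (use z in \<open>auto simp: bconst_def coeff_pCons split: nat.splits\<close>)
  then show "\<exists>c. f = bconst c" ..
next
  show "tdeg f = 0" if "\<exists>c. f = bconst c"
    using that by (auto simp: tdeg_def thom_simps) (simp add: bconst_def)
qed

lemma tdeg_bswap [simp]: "tdeg (bswap f) = tdeg f"
proof -
  have "tdeg (bswap f) \<le> n \<longleftrightarrow> tdeg f \<le> n" for n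
    unfolding tdeg_le_iff by (auto simp: coeff_bswap add.commute)
  then show ?thesis by (metis le_antisym order_refl)
qed

lemma aut_X_not_const: "is_K_algebra_aut \<rho> \<Longrightarrow> \<rho> bX \<noteq> bconst c"
  and aut_Y_not_const: "is_K_algebra_aut \<rho> \<Longrightarrow> \<rho> bY \<noteq> bconst c"
proof -
  assume a: "is_K_algebra_aut \<rho>"
  note h = hom_const[OF hom_inv[OF a]] aut_inv_left_apply[OF a]
  show "\<rho> bX \<noteq> bconst c" using h(1)[of c] h(2)[of bX] by (auto simp: bX_def bconst_def)
  show "\<rho> bY \<noteq> bconst c" using h(1)[of c] h(2)[of bY] by (auto simp: bY_def bconst_def)
qed

lemma tdeg_aut_pos:
  assumes "is_K_algebra_aut \<rho>"
  shows "tdeg (\<rho> bX) > 0" "tdeg (\<rho> bY) > 0"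
  using aut_X_not_const[OF assms] aut_Y_not_const[OF assms] tdeg_eq_0_iff by blast+

lemma coeff_mult_top:
  fixes p q :: "'a::comm_semiring_0 poly"
  assumes "degree p \<le> a" "degree q \<le> b"
  shows "coeff (p * q) (a + b) = coeff p a * coeff q b"
proof (cases "degree p = a \<and> degree q = b")
  case True
  then show ?thesis using coeff_mult_degree_sum[of p q] by simp
next
  case False
  then have "degree (p * q) < a + b"
    using assms degree_mult_le[of p q] by linarith
  then show ?thesis using False assms by (auto simp: coeff_eq_0)
qed

lemma coeff_power_top:
  fixes p :: "'a::comm_semiring_1 poly"
  assumes "degree p \<le> a"
  shows "degree (p ^ n) \<le> a * n" "coeff (p ^ n) (a * n) = coeff p a ^ n"
proof -
  show d: "degree (p ^ n) \<le> a * n" for n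
    using degree_power_le[of p n] assms by (meson dual_order.trans mult_le_mono1)
  show "coeff (p ^ n) (a * n) = coeff p a ^ n"
    by (induction n) (auto simp: coeff_mult_top[OF assms d])
qed

section \<open>The degrees of the components of an automorphism\<close>

definition inner_pderiv :: "'a::field bipoly \<Rightarrow> 'a bipoly" where
  "inner_pderiv f = bswap (pderiv (bswap f))"

lemma coeff_inner_pderiv: "coeff (inner_pderiv f) k = pderiv (coeff f k)"
proof (rule poly_eqI)
  have "coeff (of_nat n * p) i = of_nat n * coeff p i" for n i and p :: "'a poly"
    by (simp add: of_nat_mult_conv_smult)
  then show "coeff (coeff (inner_pderiv f) k) i = coeff (pderiv (coeff f k)) i" for i
    by (simp add: inner_pderiv_def coeff_bswap coeff_pderiv del: of_nat_Suc)
qed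

lemma inner_pderiv_add: "inner_pderiv (f + g) = inner_pderiv f + inner_pderiv g"
  by (simp add: inner_pderiv_def hom_simps[OF hom_bswap] pderiv_add)

lemma inner_pderiv_mult: "inner_pderiv (f * g) = f * inner_pderiv g + g * inner_pderiv f"
  by (simp add: inner_pderiv_def hom_simps[OF hom_bswap] pderiv_mult)

lemma inner_pderiv_const: "inner_pderiv (bconst c) = 0"
  by (simp add: inner_pderiv_def hom_simps[OF hom_bswap]) (simp add: bconst_def hom_simps[OF hom_bswap])

lemma degree_inner_pderiv_le: "degree (inner_pderiv f) \<le> degree f"
  by (rule degree_le) (simp add: coeff_inner_pderiv coeff_eq_0)

definition jacobian :: "'a::field bipoly \<Rightarrow> 'a bipoly \<Rightarrow> 'a bipoly" where
  "jacobian f g = pderiv f * inner_pderiv g - inner_pderiv f * pderiv g"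

lemma jacobian_add: "jacobian f (g + h) = jacobian f g + jacobian f h"
  by (simp add: jacobian_def inner_pderiv_add pderiv_add algebra_simps)

lemma jacobian_mult: "jacobian f (g * h) = g * jacobian f h + h * jacobian f g"
  by (simp add: jacobian_def inner_pderiv_mult pderiv_mult algebra_simps)

lemma jacobian_const: "jacobian f (bconst c) = 0"
  by (simp add: jacobian_def inner_pderiv_const) (simp add: bconst_def)

lemma jacobian_self: "jacobian f f = 0"
  by (simp add: jacobian_def mult.commute)

lemma jacobian_swap: "jacobian g f = - jacobian f g"
  by (simp add: jacobian_def mult.commute)

text \<open>Each product contains one derivative in the outer variable, which costs a degree, and
  one in the inner variable, which does not raise it.\<close>

lemma degree_jacobian:
  fixes f g :: "'a::field_char_0 bipoly"
  assumes "jacobian f g \<noteq> 0"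
  shows "degree (jacobian f g) < degree f + degree g"
proof -
  have *: "degree (pderiv a * inner_pderiv b) < degree a + degree b"
    if "pderiv a * inner_pderiv b \<noteq> 0" for a b :: "'a bipoly"
  proof -
    have "pderiv a \<noteq> 0" using that by auto
    then have "degree a > 0" by (simp add: pderiv_eq_0_iff)
    moreover have "degree (pderiv a * inner_pderiv b) \<le> (degree a - 1) + degree b"
      using degree_mult_le[of "pderiv a" "inner_pderiv b"] degree_inner_pderiv_le[of b]
      by (simp add: degree_pderiv)
    ultimately show ?thesis by simp
  qed
  show ?thesis
  proof (cases "pderiv f * inner_pderiv g = 0 \<or> pderiv g * inner_pderiv f = 0")
    case True
    then show ?thesis using *[of f g] *[of g f] assms unfolding jacobian_def
      by (auto simp: mult.commute add.commute)
  next
    case False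
    then show ?thesis using *[of f g] *[of g f] unfolding jacobian_def
      by (intro degree_diff_less) (auto simp: mult.commute add.commute)
  qed
qed

lemma coeff_jacobian_top:
  fixes f g :: "'a::field_char_0 bipoly"
  assumes "degree f = Suc a" "degree g = Suc b"
  shows "coeff (jacobian f g) (Suc (a + b)) = of_nat (Suc a) * lead_coeff f * pderiv (lead_coeff g)
           - of_nat (Suc b) * pderiv (lead_coeff f) * lead_coeff g"
proof -
  have "coeff (pderiv f * inner_pderiv g) (a + Suc b) = coeff (pderiv f) a * coeff (inner_pderiv g) (Suc b)"
    by (rule coeff_mult_top) (use assms degree_inner_pderiv_le[of g] in \<open>auto simp: degree_pderiv\<close>)
  moreover have "coeff (inner_pderiv f * pderiv g) (Suc a + b) = coeff (inner_pderiv f) (Suc a) * coeff (pderiv g) b"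
    by (rule coeff_mult_top) (use assms degree_inner_pderiv_le[of f] in \<open>auto simp: degree_pderiv\<close>)
  ultimately show ?thesis
    by (simp add: jacobian_def assms coeff_inner_pderiv coeff_pderiv mult_ac del: of_nat_Suc)
qed

text \<open>At t = 0 the point (t, u t) does not depend on u, so both inner derivatives vanish
  there. This is the factor t in the Jacobian of the substitution itself.\<close>

lemma coeff_0_jacobian_thom: "coeff (jacobian (thom f) (thom g)) 0 = 0"
proof -
  have "pderiv (coeff (thom f) 0) = 0" for f :: "'a bipoly"
  proof -
    have "coeff (thom f) 0 = [:coeff (coeff f 0) 0:]"
      by (rule poly_eqI) (auto simp: coeff_thom coeff_pCons split: nat.splits)
    then show ?thesis by simp
  qed
  then show ?thesis by (simp add: jacobian_def coeff_mult_0 coeff_inner_pderiv)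
qed

text \<open>The Jacobian with fixed first argument \<open>\<rho> bX\<close> is a derivation that
  kills \<open>\<rho> bX\<close>, so only the derivative of \<open>P\<close> in y survives.\<close>

lemma jacobian_chain:
  assumes h: "alg_hom \<rho>"
  shows "jacobian (\<rho> bX) (\<rho> P) = jacobian (\<rho> bX) (\<rho> bY) * \<rho> (pderiv P)"
proof (induction P rule: bipoly_induct)
  case (const c)
  have "pderiv (bconst c) = 0" by (simp add: bconst_def)
  then show ?case by (simp add: hom_simps[OF h] jacobian_const)
next
  case X
  have "pderiv bX = (0 :: 'a bipoly)" by (simp add: bX_def)
  then show ?case by (simp add: hom_simps[OF h] jacobian_self)
next
  case Y
  have "pderiv bY = (1 :: 'a bipoly)" by (simp add: bY_def pderiv_pCons)
  then show ?case by (simp add: hom_simps[OF h])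
next
  case (add f g)
  then show ?case by (simp add: hom_simps[OF h] jacobian_add pderiv_add algebra_simps)
next
  case (mult f g)
  then show ?case by (simp add: hom_simps[OF h] jacobian_mult pderiv_mult algebra_simps)
qed

text \<open>In fact \<open>c\<close> is a constant multiple of t, but these bounds suffice. Since
  \<open>\<rho>\<close> is surjective, the chain rule lets \<open>c\<close> divide the Jacobian of
  \<open>thom (\<rho> bX)\<close> with every \<open>thom f\<close>. For the two coordinates these
  are, with F = \<open>thom (\<rho> bX)\<close>, -F_u and t F_t - u F_u.\<close>

lemma jacobian_thom_aut:
  fixes \<rho> :: "'a::field_char_0 bipoly \<Rightarrow> 'a bipoly"
  assumes a: "is_K_algebra_aut \<rho>"
  defines "c \<equiv> jacobian (thom (\<rho> bX)) (thom (\<rho> bY))"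
  shows "c \<noteq> 0" "degree c \<le> tdeg (\<rho> bX)" "degree c > 0"
proof -
  define F where "F = thom (\<rho> bX)"
  have chain: "jacobian F (thom f) = c * thom (\<rho> (pderiv (inv \<rho> f)))" for f
    using jacobian_chain[OF hom_comp[OF hom_thom aut_hom[OF a]], of "inv \<rho> f"]
    by (simp add: F_def c_def aut_inv_right_apply[OF a])
  have F: "degree F > 0" using tdeg_aut_pos[OF a] by (simp add: F_def tdeg_def)
  have basic: "inner_pderiv bY = (0 :: 'a bipoly)" "inner_pderiv bX = (1 :: 'a bipoly)"
    "pderiv bX = (0 :: 'a bipoly)" "pderiv bY = (1 :: 'a bipoly)"
    by (simp_all add: inner_pderiv_def)
       (simp_all add: bX_def bY_def hom_simps[OF hom_bswap] pderiv_pCons pCons_one)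
  have 1: "- inner_pderiv F = c * thom (\<rho> (pderiv (inv \<rho> bX)))"
    by (simp flip: chain add: jacobian_def basic)
  have 2: "pderiv F * bY - inner_pderiv F * bX = c * thom (\<rho> (pderiv (inv \<rho> bY)))"
    by (simp flip: chain add: jacobian_def basic inner_pderiv_mult pderiv_mult)
  have pF: "pderiv F \<noteq> 0" using F by (simp add: pderiv_eq_0_iff)
  have Y0: "bY \<noteq> (0 :: 'a bipoly)" "degree (bY :: 'a bipoly) = 1" by (simp_all add: bY_def)
  show c: "c \<noteq> 0"
  proof
    assume "c = 0"
    then show False using 1 2 pF Y0 by auto
  qed
  show "degree c \<le> tdeg (\<rho> bX)"
  \<comment> \<open>If F_u vanishes, \<open>c\<close> still divides t F_t, which has the degree of
    \<open>F\<close>.\<close>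
  proof (cases "inner_pderiv F = 0")
    case True
    then have "c dvd pderiv F * bY" using 2 by (simp add: dvd_def)
    then have "degree c \<le> degree (pderiv F * bY)"
      by (rule dvd_imp_degree_le) (use pF Y0 in auto)
    also have "\<dots> = degree F" using F pF Y0 by (simp add: degree_mult_eq degree_pderiv)
    finally show ?thesis by (simp add: F_def tdeg_def)
  next
    case False
    have "c dvd inner_pderiv F" using 1 by (metis dvd_minus_iff dvd_triv_left)
    then have "degree c \<le> degree (inner_pderiv F)"
      by (rule dvd_imp_degree_le) (use False in auto)
    then show ?thesis using degree_inner_pderiv_le[of F] by (simp add: F_def tdeg_def)
  qed
  have "coeff c 0 = 0" unfolding c_def by (rule coeff_0_jacobian_thom)
  then show "degree c > 0" using c by (metis gr0I leading_coeff_0_iff)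
qed

text \<open>Of the 2, one comes from the strict bound on the degree of a Jacobian, the other from
  the factor \<open>c\<close> of positive degree in the chain rule.\<close>

lemma tdeg_aut_pderiv:
  fixes \<rho> :: "'a::field_char_0 bipoly \<Rightarrow> 'a bipoly"
  assumes a: "is_K_algebra_aut \<rho>" and nz: "pderiv P \<noteq> 0"
  shows "tdeg (\<rho> (pderiv P)) + 2 \<le> tdeg (\<rho> bX) + tdeg (\<rho> P)"
proof -
  define c where "c = jacobian (thom (\<rho> bX)) (thom (\<rho> bY))"
  note c = jacobian_thom_aut[OF a, folded c_def]
  have "\<rho> (pderiv P) \<noteq> 0"
    using nz aut_inv_left_apply[OF a, of "pderiv P"] hom_0[OF hom_inv[OF a]] by metis
  then have nz': "thom (\<rho> (pderiv P)) \<noteq> 0" by simp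
  have *: "jacobian (thom (\<rho> bX)) (thom (\<rho> P)) = c * thom (\<rho> (pderiv P))"
    using jacobian_chain[OF hom_comp[OF hom_thom aut_hom[OF a]], of P] by (simp add: c_def)
  then have "degree (jacobian (thom (\<rho> bX)) (thom (\<rho> P))) = degree c + tdeg (\<rho> (pderiv P))"
    using c nz' by (simp add: degree_mult_eq tdeg_def)
  moreover have "degree (jacobian (thom (\<rho> bX)) (thom (\<rho> P))) < tdeg (\<rho> bX) + tdeg (\<rho> P)"
    unfolding tdeg_def by (rule degree_jacobian) (use * c nz' in auto)
  ultimately show ?thesis using c by linarith
qed

section \<open>Proportional leading forms and the reduction of degrees\<close>

text \<open>The equation is linear in \<open>q\<close> and solved by \<open>p ^ k\<close>. Top
  coefficients show that every nonzero solution has degree k times that of \<open>p\<close>, so the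
  difference with the multiple of \<open>p ^ k\<close> that cancels the coefficient there is
  zero.\<close>

lemma log_derivative_eq_imp_power:
  fixes p q :: "'a::field_char_0 poly"
  assumes p: "p \<noteq> 0" and eq: "p * pderiv q = of_nat k * pderiv p * q"
  shows "\<exists>c. q = smult c (p ^ k)"
proof -
  have deg: "degree r = k * degree p" if r: "r \<noteq> 0" "p * pderiv r = of_nat k * pderiv p * r" for r
  proof -
    have pd: "coeff (pderiv s) (degree s - 1) = of_nat (degree s) * lead_coeff s" for s :: "'a poly"
      by (cases "degree s") (auto simp: coeff_pderiv pderiv_eq_0_iff[THEN iffD2] simp del: of_nat_Suc)
    have 1: "coeff (s * pderiv t) (degree s + degree t - 1) = of_nat (degree t) * lead_coeff s * lead_coeff t"
      for s t :: "'a poly"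
    proof (cases "degree t = 0")
      case True
      then have "pderiv t = 0" by (simp add: pderiv_eq_0_iff)
      then show ?thesis using True by simp
    next
      case False
      then have "coeff (s * pderiv t) (degree s + (degree t - 1)) = lead_coeff s * coeff (pderiv t) (degree t - 1)"
        by (intro coeff_mult_top) (auto simp: degree_pderiv)
      then show ?thesis using False pd[of t] by simp
    qed
    have "coeff (p * pderiv r) (degree p + degree r - 1) = coeff (smult (of_nat k) (r * pderiv p)) (degree p + degree r - 1)"
      unfolding r(2) by (simp add: of_nat_mult_conv_smult mult.commute)
    then have "of_nat (degree r) * (lead_coeff p * lead_coeff r) = of_nat (k * degree p) * (lead_coeff p * lead_coeff r)"
      using 1[of p r] 1[of r p] unfolding coeff_smult of_nat_mult
      by (simp only: add.commute[of "degree r"] mult_ac)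
    moreover have "lead_coeff p * lead_coeff r \<noteq> 0" using p r by simp
    ultimately have "of_nat (degree r) = (of_nat (k * degree p) :: 'a)"
      using mult_right_cancel by blast
    then show ?thesis using of_nat_eq_iff by blast
  qed
  define c where "c = lead_coeff q / lead_coeff p ^ k"
  define r where "r = q - smult c (p ^ k)"
  have pk: "p * pderiv (p ^ k) = of_nat k * pderiv p * p ^ k"
    by (cases k) (simp_all add: pderiv_power_Suc of_nat_mult_conv_smult mult_ac del: of_nat_Suc power_Suc, simp add: mult_ac)
  have r: "p * pderiv r = of_nat k * pderiv p * r"
    using eq pk by (simp add: r_def pderiv_diff pderiv_smult algebra_simps)
  have "r = 0"
  proof (rule ccontr)
    assume "r \<noteq> 0"
    then have dr: "degree r = k * degree p" using r by (rule deg)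
    have dp: "degree (p ^ k) = k * degree p" using p by (simp add: degree_power_eq)
    have "coeff r (k * degree p) = 0"
    proof (cases "q = 0")
      case True
      then show ?thesis by (simp add: r_def c_def)
    next
      case False
      then have "degree q = k * degree p" using eq by (rule deg)
      then show ?thesis using p dp lead_coeff_power[of p k] by (simp add: r_def c_def)
    qed
    then show False using dr \<open>r \<noteq> 0\<close> by (metis leading_coeff_0_iff)
  qed
  then show ?thesis by (auto simp: r_def)
qed

text \<open>With m and n the degrees of the components, the Jacobian has degree at most min m n,
  which is below m + n - 1 if m + n > 2. Its coefficient at m + n - 1 therefore vanishes, which
  reads m \<phi> \<gamma>' = n \<phi>' \<gamma> for the leading forms. With n = k m this makes
  \<gamma> a multiple of \<phi>^k.\<close>

lemma tdeg_reduction: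
  fixes \<rho> :: "'a::field_char_0 bipoly \<Rightarrow> 'a bipoly"
  assumes a: "is_K_algebra_aut \<rho>" and n: "tdeg (\<rho> bY) = k * tdeg (\<rho> bX)"
    and big: "tdeg (\<rho> bX) + tdeg (\<rho> bY) > 2"
  shows "\<exists>c. tdeg (\<rho> (bY - bconst c * bX ^ k)) < tdeg (\<rho> bY)"
proof -
  define F G where "F = thom (\<rho> bX)" "G = thom (\<rho> bY)"
  note h = aut_hom[OF a]
  \<comment> \<open>Exchanging the components bounds the Jacobian by the other degree as
    well.\<close>
  have a': "is_K_algebra_aut (\<rho> \<circ> bswap)" by (rule aut_comp[OF a aut_bswap])
  obtain m' n' where deg: "degree F = Suc m'" "degree G = Suc n'"
    using tdeg_aut_pos[OF a] unfolding tdeg_def F_G_def[symmetric] by (metis gr0_conv_Suc)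
  have "degree (jacobian F G) \<le> degree F"
    using jacobian_thom_aut(2)[OF a] by (simp add: F_G_def tdeg_def)
  moreover have "degree (jacobian F G) \<le> degree G"
    using jacobian_thom_aut(2)[OF a'] jacobian_swap[of G F] by (simp add: F_G_def tdeg_def)
  ultimately have "degree (jacobian F G) < Suc (m' + n')"
    using deg big unfolding tdeg_def F_G_def[symmetric] by linarith
  then have "coeff (jacobian F G) (Suc (m' + n')) = 0" by (rule coeff_eq_0)
  then have eq: "of_nat (degree F) * lead_coeff F * pderiv (lead_coeff G)
      = of_nat (degree G) * pderiv (lead_coeff F) * lead_coeff G"
    using coeff_jacobian_top[OF deg] deg by simp
  have n': "degree G = k * degree F" using n by (simp add: tdeg_def F_G_def)
  have "of_nat (degree F) * (lead_coeff F * pderiv (lead_coeff G))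
      = of_nat (degree F) * (of_nat k * pderiv (lead_coeff F) * lead_coeff G)"
    using eq by (simp add: n' mult_ac)
  moreover have "of_nat (degree F) \<noteq> (0 :: 'a poly)" by (simp add: deg del: of_nat_Suc)
  ultimately have "lead_coeff F * pderiv (lead_coeff G) = of_nat k * pderiv (lead_coeff F) * lead_coeff G"
    by simp
  moreover have F0: "F \<noteq> 0" using deg(1) by auto
  then have "lead_coeff F \<noteq> 0" by simp
  ultimately obtain c where c: "lead_coeff G = smult c (lead_coeff F ^ k)"
    using log_derivative_eq_imp_power by blast
  have dFk: "degree (F ^ k) = degree G"
    using F0 n' by (simp add: degree_power_eq)
  then have lFk: "coeff (F ^ k) (degree G) = lead_coeff F ^ k"
    using lead_coeff_power[of F k] by simp
  have eq2: "thom (\<rho> (bY - bconst c * bX ^ k)) = G - smult [:c:] (F ^ k)"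
    unfolding hom_simps[OF h] thom_simps F_G_def by (simp add: bconst_def)
  have "degree (G - smult [:c:] (F ^ k)) < degree G"
  proof (rule degree_lessI)
    show "G - smult [:c:] (F ^ k) \<noteq> 0 \<or> 0 < degree G" using deg by simp
    show "\<forall>i\<ge>degree G. coeff (G - smult [:c:] (F ^ k)) i = 0"
    proof safe
      fix i assume "degree G \<le> i"
      then consider "i = degree G" | "i > degree G" by linarith
      then show "coeff (G - smult [:c:] (F ^ k)) i = 0"
        using c dFk lFk by cases (auto simp: coeff_eq_0)
    qed
  qed
  then show ?thesis unfolding tdeg_def F_G_def(2)[symmetric] using eq2 by metis
qed

section \<open>Weighted leading parts and their order of vanishing\<close>

text \<open>Splitting off a root c^M of \<open>R\<close> splits off y^M - c^M, whose derivative M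
  c^(M-1) is nonzero at c. So each root costs at most one order.\<close>

lemma order_pcompose_monom_le:
  fixes R :: "'a::{idom,ring_char_0} poly"
  assumes R: "R \<noteq> 0" and M: "M > 0" and c: "c \<noteq> 0"
  shows "order c (pcompose R (monom 1 M)) \<le> degree R"
  using R
proof (induction "degree R" arbitrary: R rule: less_induct)
  case less
  have M1: "degree (monom 1 M :: 'a poly) > 0" using M by (simp add: degree_monom_eq)
  have nz: "pcompose S (monom 1 M) \<noteq> 0" if "S \<noteq> 0" for S :: "'a poly"
    using that pcompose_eq_0[OF _ M1] by auto
  show ?case
  proof (cases "poly R (c ^ M) = 0")
    case False
    then have "poly (pcompose R (monom 1 M)) c \<noteq> 0" by (simp add: poly_pcompose poly_monom)
    then show ?thesis by (simp add: order_0I)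
  next
    case True
    then obtain S where S: "R = [:- (c ^ M), 1:] * S" by (auto simp: poly_eq_0_iff_dvd dvd_def)
    then have S0: "S \<noteq> 0" using less.prems by auto
    then have deg: "degree R = Suc (degree S)" unfolding S by (subst degree_mult_eq) auto
    define Q where "Q = monom 1 M - [:c ^ M:]"
    have eq: "pcompose R (monom 1 M) = Q * pcompose S (monom 1 M)"
      by (simp add: S Q_def pcompose_mult pcompose_pCons del: mult_pCons_left)
    have "order c Q \<le> 1"
    proof (cases "order c Q = 0")
      case False
      have pQ: "pderiv Q = monom (of_nat M) (M - 1)" by (simp add: Q_def pderiv_diff pderiv_monom)
      have pQ0: "poly (pderiv Q) c \<noteq> 0" using M c by (simp add: pQ poly_monom)
      then have "order c (pderiv Q) = 0" by (rule order_0I)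
      moreover have "order c Q = Suc (order c (pderiv Q))"
        by (rule order_pderiv) (use pQ0 in \<open>auto simp: Q_def poly_monom\<close>)
      ultimately show ?thesis by simp
    qed simp
    moreover have "order c (pcompose R (monom 1 M)) = order c Q + order c (pcompose S (monom 1 M))"
      using nz[OF less.prems] unfolding eq by (rule order_mult)
    moreover have "order c (pcompose S (monom 1 M)) \<le> degree S"
      using less.hyps[of S] deg S0 by simp
    ultimately show ?thesis using deg by simp
  qed
qed

lemma poly_higher_pderiv_root:
  fixes Q :: "'a::{idom,ring_char_0} poly"
  shows "poly ((pderiv ^^ q) ([:-c, 1:] ^ q * Q)) c = fact q * poly Q c"
proof (induction q arbitrary: Q)
  case (Suc q)
  have "pderiv ([:-c, 1:] ^ Suc q * Q) = [:-c, 1:] ^ q * (smult (of_nat (Suc q)) Q + [:-c, 1:] * pderiv Q)"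
    unfolding pderiv_mult pderiv_power_Suc by (simp add: pderiv_pCons algebra_simps del: of_nat_Suc)
  then have "poly ((pderiv ^^ Suc q) ([:-c, 1:] ^ Suc q * Q)) c
      = fact q * poly (smult (of_nat (Suc q)) Q + [:-c, 1:] * pderiv Q) c"
    using Suc.IH by (simp only: funpow_Suc_right comp_apply)
  also have "\<dots> = fact (Suc q) * poly Q c" by (simp add: algebra_simps)
  finally show ?case .
qed simp

text \<open>The congruence of the exponents means R = y^r S(y^M), so the order \<open>q\<close> of
  \<open>R\<close> at \<open>c\<close> is at most the degree of \<open>S\<close>; this gains the
  factor \<open>M\<close>. The coefficients form only a domain because they will lie in K[u], with
  \<open>c\<close> a leading form.\<close>

lemma ex_nonvanishing_derivative:
  fixes R :: "'a::{idom,ring_char_0} poly"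
  assumes R: "R \<noteq> 0" and M: "M > 0" and c: "c \<noteq> 0"
    and conc: "\<And>j. coeff R j \<noteq> 0 \<Longrightarrow> j mod M = r"
  shows "\<exists>q. poly ((pderiv ^^ q) R) c \<noteq> 0 \<and> q * M \<le> degree R"
proof -
  define S where "S = (\<Sum>k\<le>degree R. monom (coeff R (r + k * M)) k)"
  have coeff_S: "coeff S k = coeff R (r + k * M)" for k
  proof (cases "k \<le> degree R")
    case False
    then have "degree R < r + k * M" using M by (metis One_nat_def Suc_leI linorder_not_le mult_le_mono2 nat_mult_1_right trans_le_add2 order.strict_trans2)
    then show ?thesis using False by (simp add: S_def coeff_sum coeff_eq_0)
  qed (simp add: S_def coeff_sum if_distrib cong: if_cong)
  obtain j0 where "coeff R j0 \<noteq> 0" using R by (metis leading_coeff_0_iff)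
  then have r: "r < M" using conc M by force
  have cmp: "coeff (pcompose S (monom 1 M)) i = (if M dvd i then coeff S (i div M) else 0)" for i
  proof -
    have "pcompose S (monom 1 M) = (\<Sum>k\<le>degree S. monom (coeff S k) (k * M))"
      unfolding pcompose_altdef poly_altdef
      by (simp add: degree_map_poly coeff_map_poly monom_power smult_monom mult.commute)
    then have "coeff (pcompose S (monom 1 M)) i = (\<Sum>k\<le>degree S. if k * M = i then coeff S k else 0)"
      by (simp add: coeff_sum)
    also have "\<dots> = (if M dvd i then coeff S (i div M) else 0)"
    proof (cases "M dvd i")
      case True
      then have "(\<Sum>k\<le>degree S. if k * M = i then coeff S k else 0)
          = (\<Sum>k\<le>degree S. if k = i div M then coeff S k else 0)"
        using M by (intro sum.cong) auto
      then show ?thesis using True by (simp add: coeff_eq_0)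
    next
      case False
      then show ?thesis by (auto intro!: sum.neutral)
    qed
    finally show ?thesis .
  qed
  have Req: "R = monom 1 r * pcompose S (monom 1 M)"
  proof (rule poly_eqI)
    fix j
    show "coeff R j = coeff (monom 1 r * pcompose S (monom 1 M)) j"
    proof (cases "r \<le> j \<and> M dvd (j - r)")
      case True
      then obtain k where "j - r = M * k" by auto
      then have "j = r + k * M" using True by (simp add: mult.commute)
      then show ?thesis using M by (simp add: coeff_monom_mult cmp coeff_S)
    next
      case False
      have "coeff R j = 0"
      proof (rule ccontr)
        assume "coeff R j \<noteq> 0"
        then have "j mod M = r" by (rule conc)
        then show False using False by (metis dvd_minus_mod mod_less_eq_dividend)
      qed
      then show ?thesis using False by (auto simp: coeff_monom_mult cmp)
    qed
  qed
  have S0: "S \<noteq> 0" using R Req by auto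
  define q where "q = order c R"
  have "q = order c (monom 1 r) + order c (pcompose S (monom 1 M))"
    unfolding q_def using R Req by (metis order_mult)
  moreover have "order c (monom 1 r) = 0" using c by (intro order_0I) (simp add: poly_monom)
  ultimately have "q \<le> degree S" using order_pcompose_monom_le[OF S0 M c] by simp
  moreover have "degree R = r + degree S * M"
    using R Req S0 M pcompose_eq_0[of S "monom 1 M"]
    by (subst Req, subst degree_mult_eq) (auto simp: degree_monom_eq degree_pcompose monom_eq_0_iff)
  ultimately have qM: "q * M \<le> degree R" by (simp add: trans_le_add2)
  obtain Q where Q: "R = [:-c, 1:] ^ q * Q" "\<not> [:-c, 1:] dvd Q"
    using order_decomp[OF R] unfolding q_def by blast
  then have "poly Q c \<noteq> 0" by (simp add: poly_eq_0_iff_dvd)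
  then have "poly ((pderiv ^^ q) R) c \<noteq> 0"
    using poly_higher_pderiv_root[of q c Q] by (simp flip: Q(1))
  then show ?thesis using qM by blast
qed

text \<open>The part of \<open>P\<close> of weight \<open>w\<close>, for the weights \<open>m\<close> of \<open>x\<close> and \<open>n\<close> of \<open>y\<close>, with \<open>\<phi>\<close>
  substituted for \<open>x\<close>.\<close>
definition wpart :: "'a::field poly \<Rightarrow> nat \<Rightarrow> nat \<Rightarrow> nat \<Rightarrow> 'a bipoly \<Rightarrow> 'a bipoly" where
  "wpart \<phi> m n w P = (\<Sum>j\<le>degree P. monom
     (if n * j \<le> w \<and> m dvd w - n * j
      then smult (coeff (coeff P j) ((w - n * j) div m)) (\<phi> ^ ((w - n * j) div m)) else 0) j)"

lemma coeff_wpart: "coeff (wpart \<phi> m n w P) j =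
    (if n * j \<le> w \<and> m dvd w - n * j
     then smult (coeff (coeff P j) ((w - n * j) div m)) (\<phi> ^ ((w - n * j) div m)) else 0)"
proof -
  have "coeff (\<Sum>j\<le>N. monom (a j) j) j = (if j \<le> N then a j else 0)" for N and a :: "nat \<Rightarrow> 'a poly"
    by (simp add: coeff_sum)
  then show ?thesis by (auto simp: wpart_def coeff_eq_0)
qed

definition weight_le :: "nat \<Rightarrow> nat \<Rightarrow> nat \<Rightarrow> 'a::zero bipoly \<Rightarrow> bool" where
  "weight_le m n w P \<longleftrightarrow> (\<forall>i j. coeff (coeff P j) i \<noteq> 0 \<longrightarrow> m * i + n * j \<le> w)"

lemma coeff_of_nat_mult: "coeff (of_nat k * p) i = of_nat k * coeff p i"
  by (simp add: of_nat_mult_conv_smult)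

lemma wpart_pderiv:
  assumes "n \<le> w"
  shows "wpart \<phi> m n (w - n) (pderiv P) = pderiv (wpart \<phi> m n w P)"
proof (rule poly_eqI)
  fix j
  have "n * j \<le> w - n \<longleftrightarrow> n * Suc j \<le> w" "w - n - n * j = w - n * Suc j"
    using assms by (auto simp: algebra_simps)
  then show "coeff (wpart \<phi> m n (w - n) (pderiv P)) j = coeff (pderiv (wpart \<phi> m n w P)) j"
    by (auto simp: coeff_wpart coeff_pderiv coeff_of_nat_mult of_nat_mult_conv_smult
        simp del: of_nat_Suc mult_Suc_right)
qed

lemma weight_le_pderiv:
  assumes "weight_le m n w P"
  shows "weight_le m n (w - n) (pderiv P)"
  unfolding weight_le_def
proof (intro allI impI)
  fix i j assume "coeff (coeff (pderiv P) j) i \<noteq> 0"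
  then have "coeff (coeff P (Suc j)) i \<noteq> 0"
    by (auto simp: coeff_pderiv coeff_of_nat_mult simp del: of_nat_Suc)
  then have "m * i + n * Suc j \<le> w" using assms unfolding weight_le_def by blast
  then show "m * i + n * j \<le> w - n" by simp
qed

lemma wpart_higher_pderiv:
  assumes "weight_le m n w P" "q * n \<le> w"
  shows "weight_le m n (w - q * n) ((pderiv ^^ q) P)"
    "wpart \<phi> m n (w - q * n) ((pderiv ^^ q) P) = (pderiv ^^ q) (wpart \<phi> m n w P)"
proof -
  have "weight_le m n (w - q * n) ((pderiv ^^ q) P) \<and>
    wpart \<phi> m n (w - q * n) ((pderiv ^^ q) P) = (pderiv ^^ q) (wpart \<phi> m n w P)"
    using assms(2)
  proof (induction q)
    case (Suc q)
    have e: "w - Suc q * n = w - q * n - n" "n \<le> w - q * n" using Suc.prems by auto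
    have "q * n \<le> w" using Suc.prems by simp
    with Suc.IH show ?case unfolding e
      using weight_le_pderiv[of m n "w - q * n" "(pderiv ^^ q) P"] wpart_pderiv[OF e(2), of \<phi> m "(pderiv ^^ q) P"]
      by simp
  qed (use assms in simp)
  then show "weight_le m n (w - q * n) ((pderiv ^^ q) P)"
    "wpart \<phi> m n (w - q * n) ((pderiv ^^ q) P) = (pderiv ^^ q) (wpart \<phi> m n w P)" by auto
qed

text \<open>A monomial of weight v is mapped to a polynomial of degree at most v in the outer
  variable. Hence degree \<open>w\<close> receives only the part of weight \<open>w\<close>, through
  products of top coefficients.\<close>

lemma coeff_hom_weight:
  assumes h: "alg_hom \<sigma>" and P: "weight_le m n w P" and m: "m > 0"
    and F: "degree (\<sigma> bX) \<le> m" and G: "degree (\<sigma> bY) \<le> n"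
  shows "coeff (\<sigma> P) w = poly (wpart (coeff (\<sigma> bX) m) m n w P) (coeff (\<sigma> bY) n)"
proof -
  define \<phi> where "\<phi> = coeff (\<sigma> bX) m"
  define \<gamma> where "\<gamma> = coeff (\<sigma> bY) n"
  have mono: "coeff (bconst c * \<sigma> bX ^ i * \<sigma> bY ^ j) w = (if m * i + n * j = w then smult c (\<phi> ^ i * \<gamma> ^ j) else 0)"
    if "c \<noteq> 0 \<Longrightarrow> m * i + n * j \<le> w" for c i j
  proof (cases "c = 0")
    case False
    note Fi = coeff_power_top[OF F, of i] and Gj = coeff_power_top[OF G, of j]
    have top: "coeff (\<sigma> bX ^ i * \<sigma> bY ^ j) (m * i + n * j) = \<phi> ^ i * \<gamma> ^ j"
      using coeff_mult_top[OF Fi(1) Gj(1)] Fi(2) Gj(2) by (simp add: \<phi>_def \<gamma>_def)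
    have "degree (\<sigma> bX ^ i * \<sigma> bY ^ j) \<le> m * i + n * j"
      using degree_mult_le[of "\<sigma> bX ^ i" "\<sigma> bY ^ j"] Fi(1) Gj(1) by linarith
    then have "coeff (\<sigma> bX ^ i * \<sigma> bY ^ j) w = (if m * i + n * j = w then \<phi> ^ i * \<gamma> ^ j else 0)"
      using top that[OF False] by (auto simp: coeff_eq_0)
    then show ?thesis by (simp add: bconst_def mult.assoc)
  qed (simp add: bconst_0)
  have inner: "(\<Sum>i\<le>degree (coeff P j). if m * i + n * j = w then smult (coeff (coeff P j) i) (\<phi> ^ i * \<gamma> ^ j) else 0)
      = coeff (wpart \<phi> m n w P) j * \<gamma> ^ j" for j
  proof (cases "n * j \<le> w \<and> m dvd w - n * j")
    case True
    then obtain k where k: "w - n * j = m * k" by auto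
    then have "m * i + n * j = w \<longleftrightarrow> i = k" for i using True m by auto
    then have "(\<Sum>i\<le>degree (coeff P j). if m * i + n * j = w then smult (coeff (coeff P j) i) (\<phi> ^ i * \<gamma> ^ j) else 0)
      = smult (coeff (coeff P j) k) (\<phi> ^ k * \<gamma> ^ j)"
      by (simp add: coeff_eq_0)
    then show ?thesis using True k m by (simp add: coeff_wpart)
  next
    case False
    then have "m * i + n * j \<noteq> w" for i by auto
    then show ?thesis using False by (auto simp: coeff_wpart)
  qed
  have "coeff (\<sigma> P) w = (\<Sum>j\<le>degree P. \<Sum>i\<le>degree (coeff P j).
      if m * i + n * j = w then smult (coeff (coeff P j) i) (\<phi> ^ i * \<gamma> ^ j) else 0)"
    unfolding hom_expand[OF h, of P] coeff_sum
    by (intro sum.cong refl mono) (use P in \<open>auto simp: weight_le_def\<close>)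
  also have "\<dots> = (\<Sum>j\<le>degree P. coeff (wpart \<phi> m n w P) j * \<gamma> ^ j)"
    by (simp only: inner)
  also have "\<dots> = poly (wpart \<phi> m n w P) \<gamma>"
    unfolding coeff_wpart by (simp only: wpart_def poly_sum poly_monom)
  finally show ?thesis by (simp add: \<phi>_def \<gamma>_def)
qed

text \<open>For P with \<open>\<rho> P = bX\<close> and maximal weight w, the part \<open>R\<close>
  of weight w satisfies q lcm m n \<le> n deg R \<le> w. By \<open>tdeg_aut_pderiv\<close> every
  derivative adds at most m - 2 to the degree of the image, which starts at 1, so w - q n \<le> 1 +
  q (m - 2). For q > 0 this gives lcm m n < m + n. If neither degree divides the other, their lcm is
  at least 2 m and 2 n.\<close>

lemma tdeg_aut_dvd:
  fixes \<rho> :: "'a::field_char_0 bipoly \<Rightarrow> 'a bipoly"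
  assumes a: "is_K_algebra_aut \<rho>"
  shows "tdeg (\<rho> bX) dvd tdeg (\<rho> bY) \<or> tdeg (\<rho> bY) dvd tdeg (\<rho> bX)"
proof -
  define m where "m = tdeg (\<rho> bX)"
  define n where "n = tdeg (\<rho> bY)"
  have mn: "m > 0" "n > 0" using tdeg_aut_pos[OF a] by (auto simp: m_def n_def)
  define \<phi> where "\<phi> = lead_coeff (thom (\<rho> bX))"
  define \<gamma> where "\<gamma> = lead_coeff (thom (\<rho> bY))"
  have lead: "\<phi> \<noteq> 0" "\<gamma> \<noteq> 0"
    using mn by (auto simp: \<phi>_def \<gamma>_def m_def n_def tdeg_def thom_simps simp del: thom_eq_0_iff)
  define P where "P = inv \<rho> bX"
  have P: "\<rho> P = bX" by (simp add: P_def aut_inv_right_apply[OF a])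
  obtain i1 j1 where nonconst: "coeff (coeff P j1) i1 \<noteq> 0" "i1 + j1 > 0"
  proof -
    have "tdeg P \<noteq> 0"
      using aut_X_not_const[OF aut_inv[OF a]] by (auto simp: tdeg_eq_0_iff P_def)
    then show ?thesis using that tdeg_le_iff[of P 0] by auto
  qed
  define W where "W = {m * i + n * j | i j. coeff (coeff P j) i \<noteq> 0}"
  have "W \<subseteq> (\<Union>j\<le>degree P. (\<lambda>i. m * i + n * j) ` {..degree (coeff P j)})"
  proof
    fix x assume "x \<in> W"
    then obtain i j where x: "x = m * i + n * j" "coeff (coeff P j) i \<noteq> 0" by (auto simp: W_def)
    then have "j \<le> degree P" "i \<le> degree (coeff P j)" by (auto intro!: le_degree)
    then show "x \<in> (\<Union>j\<le>degree P. (\<lambda>i. m * i + n * j) ` {..degree (coeff P j)})" using x by auto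
  qed
  then have finW: "finite W" by (rule finite_subset) auto
  define w where "w = Max W"
  have "w \<in> W" unfolding w_def using finW nonconst by (intro Max_in) (auto simp: W_def)
  then obtain i0 j0 where w: "w = m * i0 + n * j0" "coeff (coeff P j0) i0 \<noteq> 0" by (auto simp: W_def)
  have wle: "weight_le m n w P"
    unfolding weight_le_def w_def using finW by (auto intro!: Max_ge simp: W_def)
  define R where "R = wpart \<phi> m n w P"
  have "coeff R j0 \<noteq> 0" using w mn lead by (simp add: R_def coeff_wpart)
  then have R: "R \<noteq> 0" by auto
  define M where "M = m div gcd m n"
  have M: "M > 0" using mn by (simp add: M_def div_greater_zero_iff gcd_le1_nat)
  have Mn: "M * n = lcm m n"
    by (simp add: M_def lcm_nat_def) (metis div_mult_swap gcd_dvd1 mult.commute)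
  have Rj: "n * j \<le> w" "m dvd w - n * j" if "coeff R j \<noteq> 0" for j
    using that by (auto simp: R_def coeff_wpart split: if_splits)
  \<comment> \<open>The exponents in \<open>R\<close> satisfy n j = w modulo m, which determines j
    modulo m / gcd m n.\<close>
  have conc: "j mod M = j0 mod M" if j: "coeff R j \<noteq> 0" for j
  proof -
    have "int m dvd int (w - n * j0) - int (w - n * j)"
      using Rj[OF j] Rj[OF \<open>coeff R j0 \<noteq> 0\<close>] by (intro dvd_diff) (simp_all only: int_dvd_int_iff)
    moreover have "int (w - n * j0) - int (w - n * j) = int n * (int j - int j0)"
      using Rj[OF j] Rj[OF \<open>coeff R j0 \<noteq> 0\<close>] by (simp add: of_nat_diff algebra_simps)
    ultimately have "int m dvd int n * (int j - int j0)" by simp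
    moreover have m: "int m = int M * int (gcd m n)" "int n = int (n div gcd m n) * int (gcd m n)"
      by (simp_all add: M_def flip: of_nat_mult)
    ultimately have "int M * int (gcd m n) dvd int (n div gcd m n) * (int j - int j0) * int (gcd m n)"
      by (metis (no_types, lifting) mult.assoc mult.commute)
    then have "int M dvd int (n div gcd m n) * (int j - int j0)"
      using mn by (subst (asm) dvd_times_right_cancel_iff) auto
    moreover have "coprime (int M) (int (n div gcd m n))"
      using mn div_gcd_coprime[of m n] by (simp add: M_def)
    ultimately have "int M dvd int j - int j0" using coprime_dvd_mult_right_iff by blast
    then have "int j mod int M = int j0 mod int M" by (simp add: mod_eq_dvd_iff)
    then show ?thesis by (metis of_nat_eq_iff zmod_int)
  qed
  obtain q where q: "poly ((pderiv ^^ q) R) \<gamma> \<noteq> 0" "q * M \<le> degree R"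
    using ex_nonvanishing_derivative[OF R M lead(2) conc] by blast
  have "n * degree R \<le> w" using Rj R by simp
  moreover have "q * lcm m n \<le> n * degree R"
    using mult_le_mono2[OF q(2), of n] unfolding Mn[symmetric] by (simp only: mult_ac)
  ultimately have qw: "q * lcm m n \<le> w" by simp
  have "n \<le> lcm m n" using mn by (simp add: dvd_imp_le lcm_pos_nat)
  then have qn: "q * n \<le> w" using qw by (meson mult_le_mono2 order_trans)
  define Q where "Q = (pderiv ^^ q) P"
  have "coeff (thom (\<rho> Q)) (w - q * n) = poly ((pderiv ^^ q) R) \<gamma>"
    using coeff_hom_weight[OF hom_comp[OF hom_thom aut_hom[OF a]]
        wpart_higher_pderiv(1)[OF wle qn] mn(1)] wpart_higher_pderiv(2)[OF wle qn, of \<phi>]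
    by (simp add: Q_def R_def \<phi>_def \<gamma>_def m_def n_def tdeg_def)
  then have low: "w - q * n \<le> tdeg (\<rho> Q)" and Q0: "Q \<noteq> 0"
    using q(1) by (auto simp: tdeg_def intro: le_degree) (auto simp: hom_0[OF aut_hom[OF a]] thom_simps)
  have "(pderiv ^^ k) P \<noteq> 0 \<Longrightarrow> tdeg (\<rho> ((pderiv ^^ k) P)) + 2 * k \<le> k * m + 1" for k
  proof (induction k)
    case 0
    have "tdeg (bX :: 'a bipoly) = 1" by (simp add: tdeg_def) (simp add: bY_def)
    then show ?case by (simp add: P)
  next
    case (Suc k)
    then have "(pderiv ^^ k) P \<noteq> 0" by auto
    then have "tdeg (\<rho> ((pderiv ^^ k) P)) + 2 * k \<le> k * m + 1" by (rule Suc.IH)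
    moreover have "tdeg (\<rho> ((pderiv ^^ Suc k) P)) + 2 \<le> m + tdeg (\<rho> ((pderiv ^^ k) P))"
      using tdeg_aut_pderiv[OF a, of "(pderiv ^^ k) P"] Suc.prems by (simp add: m_def)
    ultimately show ?case by simp
  qed
  from this[of q] Q0 have "tdeg (\<rho> Q) + 2 * q \<le> q * m + 1" by (simp add: Q_def)
  with low have main: "w + 2 * q \<le> q * m + q * n + 1" using qn by linarith
  have "m dvd n \<or> n dvd m"
  proof (cases "q = 0")
    \<comment> \<open>Here w is at most the degree 1 of x, and a nonconstant monomial of
      \<open>P\<close> of weight at most 1 forces m = 1 or n = 1.\<close>
    case True
    then have "w \<le> 1" using main by simp
    moreover have "m * i1 + n * j1 \<le> w" using wle nonconst(1) unfolding weight_le_def by blast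
    ultimately have "m * i1 + n * j1 \<le> 1" by simp
    then have "m = 1 \<or> n = 1" using nonconst(2) mn by (cases i1; cases j1) auto
    then show ?thesis by auto
  next
    case False
    have "q * lcm m n < q * (m + n)" using main qw False by (simp add: algebra_simps)
    then have lt: "lcm m n < m + n" by simp
    show ?thesis
    proof (rule ccontr)
      assume "\<not> (m dvd n \<or> n dvd m)"
      then have ne: "lcm m n \<noteq> m" "lcm m n \<noteq> n" by (metis dvd_lcm2, metis dvd_lcm1)
      have "2 * x \<le> l" if "x dvd l" "l \<noteq> x" "l > 0" for x l :: nat
      proof -
        obtain k where "l = x * k" using \<open>x dvd l\<close> ..
        then have "k \<ge> 2" using that by (cases k rule: nat.exhaust; cases "k = 1") auto
        then show ?thesis using \<open>l = x * k\<close> by (simp add: mult.commute)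
      qed
      from this[of m "lcm m n"] this[of n "lcm m n"] ne mn have "2 * m \<le> lcm m n" "2 * n \<le> lcm m n"
        by (auto simp: lcm_pos_nat)
      then show False using lt by simp
    qed
  qed
  then show ?thesis by (simp add: m_def n_def)
qed

section \<open>Generation by triangular automorphisms and the swap\<close>

text \<open>Every factor carries its own swap, so concatenation of words is composition and rotation
  of a word is conjugation.\<close>

fun swap_prod :: "('a::field bipoly \<Rightarrow> 'a bipoly) list \<Rightarrow> 'a bipoly \<Rightarrow> 'a bipoly" where
  "swap_prod [] = id"
| "swap_prod (\<beta> # \<beta>s) = \<beta> \<circ> bswap \<circ> swap_prod \<beta>s"

lemma swap_prod_append: "swap_prod (xs @ ys) = swap_prod xs \<circ> swap_prod ys"
  by (induction xs) (auto simp: comp_assoc)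

lemma aut_swap_prod: "\<forall>\<beta>\<in>set \<beta>s. triangular \<beta> \<Longrightarrow> is_K_algebra_aut (swap_prod \<beta>s)"
  by (induction \<beta>s) (simp_all add: aut_id aut_comp aut_bswap aut_triangular)

definition tame :: "('a::field bipoly \<Rightarrow> 'a bipoly) \<Rightarrow> bool" where
  "tame \<rho> \<longleftrightarrow> (\<exists>\<beta>s \<beta>. (\<forall>\<beta>\<in>set \<beta>s. triangular \<beta>) \<and> triangular \<beta> \<and> \<rho> = swap_prod \<beta>s \<circ> \<beta>)"

lemma tame_triangular: "triangular \<beta> \<Longrightarrow> tame \<beta>"
  unfolding tame_def by (rule exI[of _ "[]"]) auto

lemma tame_comp_triangular: "tame \<rho> \<Longrightarrow> triangular \<beta> \<Longrightarrow> tame (\<rho> \<circ> \<beta>)"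
  unfolding tame_def by (metis comp_assoc triangular_comp)

lemma tame_comp_bswap:
  assumes "tame \<rho>"
  shows "tame (\<rho> \<circ> bswap)"
proof -
  obtain \<beta>s \<beta> where "\<forall>\<beta>\<in>set \<beta>s. triangular \<beta>" "triangular \<beta>" "\<rho> = swap_prod \<beta>s \<circ> \<beta>"
    using assms by (auto simp: tame_def)
  then have "\<forall>\<beta>\<in>set (\<beta>s @ [\<beta>]). triangular \<beta>" "\<rho> \<circ> bswap = swap_prod (\<beta>s @ [\<beta>]) \<circ> id"
    by (auto simp: swap_prod_append comp_assoc)
  then show ?thesis unfolding tame_def using triangular_id by blast
qed

lemma tame_bswap_cancel: "tame (\<rho> \<circ> bswap) \<Longrightarrow> tame \<rho>"
  using tame_comp_bswap[of "\<rho> \<circ> bswap"] by (simp add: comp_assoc bswap_comp_bswap)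

lemma tame_comp_shear:
  assumes "tame (\<rho> \<circ> bsubst bX (bY - [:p:]))"
  shows "tame \<rho>"
proof -
  have tri: "triangular (bsubst bX (bY + [:q:]))" for q :: "'a poly"
    by (rule triangularI[OF hom_bsubst, where \<alpha> = 1 and \<delta> = 1 and \<gamma> = 0 and p = q])
       (simp_all add: bconst_1 bconst_0)
  have "bsubst bX (bY - [:p:]) \<circ> bsubst bX (bY + [:p:]) = id"
  proof (rule hom_eqI)
    have "bsubst bX (bY - [:p:]) [:p:] = [:p:]"
      using hom_const_poly_affine[OF hom_bsubst, of bX "bY - [:p:]" 1 0 p] by (simp add: bconst_1 bconst_0)
    then show "(bsubst bX (bY - [:p:]) \<circ> bsubst bX (bY + [:p:])) bY = id bY"
      by (simp add: hom_simps[OF hom_bsubst])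
  qed (auto intro: hom_comp hom_bsubst hom_id)
  then have "\<rho> = (\<rho> \<circ> bsubst bX (bY - [:p:])) \<circ> bsubst bX (bY + [:p:])"
    by (simp add: comp_assoc)
  then show ?thesis using tame_comp_triangular[OF assms tri] by metis
qed

lemma aut_shear: "is_K_algebra_aut (bsubst bX (bY - [:p:]))"
  by (rule aut_triangular, rule triangularI[OF hom_bsubst, where \<alpha> = 1 and \<delta> = 1 and \<gamma> = 0 and p = "- p"])
     (simp_all add: bconst_1 bconst_0)

lemma aut_not_univariate:
  assumes a: "is_K_algebra_aut \<rho>" and X: "\<rho> bX = [:p:]" and Y: "\<rho> bY = [:q:]"
  shows False
proof -
  have "\<exists>r. \<rho> f = [:r:]" for f
  proof (induction f rule: bipoly_induct)
    case (const c)
    then show ?case by (simp add: hom_simps[OF aut_hom[OF a]]) (simp add: bconst_def)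
  qed (use X Y in \<open>auto simp: hom_simps[OF aut_hom[OF a]]\<close>)
  then obtain r where "\<rho> (inv \<rho> bY) = [:r:]" by blast
  then show False by (simp add: aut_inv_right_apply[OF a]) (simp add: bY_def)
qed

lemma tdeg_le_1_eq:
  assumes "tdeg f \<le> 1"
  shows "f = bconst (coeff (coeff f 1) 0) * bY + [:[:coeff (coeff f 0) 0, coeff (coeff f 0) 1:]:]"
proof (intro poly_eqI)
  fix i j
  have z: "coeff (coeff f j) i = 0" if "i + j > 1"
    using assms that by (auto simp: tdeg_le_iff)
  consider "j = 0" "i = 0" | "j = 0" "i = 1" | "j = 1" "i = 0" | "i + j > 1" by linarith
  then show "coeff (coeff f j) i = coeff (coeff (bconst (coeff (coeff f 1) 0) * bY +
      [:[:coeff (coeff f 0) 0, coeff (coeff f 0) 1:]:]) j) i"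
    by cases (use z in \<open>auto simp: bconst_def bY_def coeff_pCons split: nat.splits\<close>)
qed

lemma triangular_of_tdeg_le_1:
  assumes a: "is_K_algebra_aut \<rho>" and X: "tdeg (\<rho> bX) \<le> 1" and Y: "tdeg (\<rho> bY) \<le> 1"
    and no: "coeff (coeff (\<rho> bX) 1) 0 = 0"
  shows "triangular \<rho>"
proof -
  obtain \<gamma> \<alpha> where X': "\<rho> bX = bconst \<alpha> * bX + bconst \<gamma>"
    using tdeg_le_1_eq[OF X] no by (auto simp: affine_X bconst_0)
  obtain \<delta> p where Y': "\<rho> bY = bconst \<delta> * bY + [:p:]"
    using tdeg_le_1_eq[OF Y] by blast
  have "\<alpha> \<noteq> 0" using aut_X_not_const[OF a, of \<gamma>] X' by (auto simp: bconst_0)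
  moreover have "\<delta> \<noteq> 0" using aut_not_univariate[OF a, of "[:\<gamma>, \<alpha>:]" p] X' Y' by (auto simp: affine_X bconst_0)
  ultimately show ?thesis using X' Y' by (intro triangularI[OF aut_hom[OF a]])
qed

text \<open>While the sum of the degrees exceeds 2, one divides the other and a shear, possibly
  after a swap, lowers the sum. What remains is affine.\<close>

theorem tame_aut:
  fixes \<rho> :: "'a::field_char_0 bipoly \<Rightarrow> 'a bipoly"
  assumes "is_K_algebra_aut \<rho>"
  shows "tame \<rho>"
  using assms
proof (induction "tdeg (\<rho> bX) + tdeg (\<rho> bY)" arbitrary: \<rho> rule: less_induct)
  case less
  show ?case
  proof (cases "tdeg (\<rho> bX) + tdeg (\<rho> bY) > 2")
    case True
    have reduce: "tame \<sigma>"
      if \<sigma>: "is_K_algebra_aut \<sigma>" "tdeg (\<sigma> bX) + tdeg (\<sigma> bY) = tdeg (\<rho> bX) + tdeg (\<rho> bY)"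
        "tdeg (\<sigma> bX) dvd tdeg (\<sigma> bY)" for \<sigma> :: "'a bipoly \<Rightarrow> 'a bipoly"
    proof -
      obtain k where "tdeg (\<sigma> bY) = k * tdeg (\<sigma> bX)" using \<sigma>(3) by (metis dvd_def mult.commute)
      then obtain c where c: "tdeg (\<sigma> (bY - bconst c * bX ^ k)) < tdeg (\<sigma> bY)"
        using tdeg_reduction[OF \<sigma>(1)] \<sigma>(2) True by metis
      have "bconst c * bX ^ k = [:monom c k:]"
        by (induction k) (auto simp: bconst_def bX_def monom_0 monom_Suc mult.left_commute)
      then have *: "tdeg ((\<sigma> \<circ> bsubst bX (bY - [:monom c k:])) bX) + tdeg ((\<sigma> \<circ> bsubst bX (bY - [:monom c k:])) bY)
          < tdeg (\<rho> bX) + tdeg (\<rho> bY)"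
        using c \<sigma>(2) by simp
      have "tame (\<sigma> \<circ> bsubst bX (bY - [:monom c k:]))"
        by (rule less.hyps[OF * aut_comp[OF \<sigma>(1) aut_shear]])
      then show ?thesis by (rule tame_comp_shear)
    qed
    from tdeg_aut_dvd[OF less.prems] show ?thesis
    proof
      assume "tdeg (\<rho> bX) dvd tdeg (\<rho> bY)"
      then show ?thesis using reduce[OF less.prems] by simp
    next
      assume "tdeg (\<rho> bY) dvd tdeg (\<rho> bX)"
      then have "tame (\<rho> \<circ> bswap)" using reduce[OF aut_comp[OF less.prems aut_bswap]] by simp
      then show ?thesis by (rule tame_bswap_cancel)
    qed
  next
    case False
    then have deg: "tdeg (\<rho> bX) \<le> 1" "tdeg (\<rho> bY) \<le> 1" using tdeg_aut_pos[OF less.prems] by auto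
    show ?thesis
    proof (cases "coeff (coeff (\<rho> bX) 1) 0 = 0")
      case True
      then show ?thesis using triangular_of_tdeg_le_1[OF less.prems deg] tame_triangular by blast
    next
      case nz: False
      \<comment> \<open>This multiple of \<open>\<rho> bX\<close> cancels the y term of
        \<open>\<rho> bY\<close>; the swap then places the result in the x-component, where a
        triangular map has no y term.\<close>
      define c where "c = coeff (coeff (\<rho> bY) 1) 0 / coeff (coeff (\<rho> bX) 1) 0"
      define p where "p = [:0, c:]"
      define \<sigma> where "\<sigma> = \<rho> \<circ> bsubst bX (bY - [:p:]) \<circ> bswap"
      have p: "[:p:] = bconst c * bX" by (simp add: p_def bconst_def bX_def)
      have \<sigma>: "\<sigma> bX = \<rho> bY - smult [:c:] (\<rho> bX)" "\<sigma> bY = \<rho> bX"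
        by (simp_all add: \<sigma>_def p hom_simps[OF aut_hom[OF less.prems]]) (simp add: bconst_def)
      have "is_K_algebra_aut \<sigma>"
        unfolding \<sigma>_def by (intro aut_comp less.prems aut_shear aut_bswap)
      moreover have "tdeg (\<sigma> bX) \<le> 1"
        unfolding tdeg_le_iff \<sigma> using deg unfolding tdeg_le_iff by simp
      moreover have "coeff (coeff (\<sigma> bX) 1) 0 = 0" using nz by (simp add: \<sigma> c_def)
      ultimately have "triangular \<sigma>" using triangular_of_tdeg_le_1 deg \<sigma>(2) by metis
      then have "tame (\<rho> \<circ> bsubst bX (bY - [:p:]))"
        unfolding \<sigma>_def using tame_bswap_cancel tame_triangular by blast
      then show ?thesis by (rule tame_comp_shear)
    qed
  qed
qed

section \<open>Conjugacy classes\<close>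

definition conjugate :: "('a::field bipoly \<Rightarrow> 'a bipoly) \<Rightarrow> ('a bipoly \<Rightarrow> 'a bipoly) \<Rightarrow> bool" where
  "conjugate \<rho> \<sigma> \<longleftrightarrow> (\<exists>\<kappa>. is_K_algebra_aut \<kappa> \<and> \<kappa> \<circ> \<sigma> = \<rho> \<circ> \<kappa>)"

lemma conjugateI: "is_K_algebra_aut \<kappa> \<Longrightarrow> \<kappa> \<circ> \<sigma> = \<rho> \<circ> \<kappa> \<Longrightarrow> conjugate \<rho> \<sigma>"
  by (auto simp: conjugate_def)

lemma conjugate_refl: "conjugate \<rho> \<rho>"
  by (rule conjugateI[OF aut_id]) simp

lemma conjugate_trans:
  assumes "conjugate \<rho> \<sigma>" "conjugate \<sigma> \<tau>"
  shows "conjugate \<rho> \<tau>"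
proof -
  obtain \<kappa> \<mu> where "is_K_algebra_aut \<kappa>" "\<kappa> \<circ> \<sigma> = \<rho> \<circ> \<kappa>" "is_K_algebra_aut \<mu>" "\<mu> \<circ> \<tau> = \<sigma> \<circ> \<mu>"
    using assms by (auto simp: conjugate_def)
  then show ?thesis
    by (intro conjugateI[of "\<kappa> \<circ> \<mu>"] aut_comp) (simp_all add: comp_assoc, metis comp_assoc)
qed

lemma conjugate_comp_commute:
  assumes "is_K_algebra_aut \<kappa>"
  shows "conjugate (\<kappa> \<circ> \<sigma>) (\<sigma> \<circ> \<kappa>)"
  by (rule conjugateI[OF assms]) (simp add: comp_assoc)

text \<open>The degree of the polynomial p in a triangular map; at most 1 means that the map is
  affine.\<close>

definition shear_degree :: "('a::field bipoly \<Rightarrow> 'a bipoly) \<Rightarrow> nat" where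
  "shear_degree \<beta> = degree (coeff (\<beta> bY) 0)"

lemma triangular_shear_degree_le_1E:
  assumes "triangular \<beta>" "shear_degree \<beta> \<le> 1"
  obtains \<alpha> \<gamma> \<delta> a b where "\<alpha> \<noteq> 0" "\<delta> \<noteq> 0" "\<beta> bX = bconst \<alpha> * bX + bconst \<gamma>"
    "\<beta> bY = bconst \<delta> * bY + bconst a * bX + bconst b"
proof -
  obtain \<alpha> \<gamma> \<delta> p where 1: "\<alpha> \<noteq> 0" "\<delta> \<noteq> 0" "\<beta> bX = bconst \<alpha> * bX + bconst \<gamma>"
    "\<beta> bY = bconst \<delta> * bY + [:p:]"
    using assms(1) by (auto simp: triangular_def)
  then have "degree p \<le> 1" using assms(2) by (simp add: shear_degree_def) (simp add: bconst_def bY_def)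
  then have "p = [:coeff p 0, coeff p 1:]"
    by (intro poly_eqI) (auto simp: coeff_pCons coeff_eq_0 split: nat.splits)
  then have "[:p:] = bconst (coeff p 1) * bX + bconst (coeff p 0)" by (metis affine_X)
  then show ?thesis using that[OF 1(1-3)] 1(4) by (metis add.assoc)
qed

text \<open>Bruhat decomposition of the affine group: the swap makes \<open>\<beta>\<close>
  triangular in the opposite direction, and its off-diagonal entry \<open>a\<close> decides which
  cell it lies in.\<close>

lemma swap_triangular_swap:
  assumes tri: "triangular \<beta>" and deg: "shear_degree \<beta> \<le> 1"
  shows "triangular (bswap \<circ> \<beta> \<circ> bswap) \<or>
    (\<exists>\<mu> \<nu>. triangular \<mu> \<and> triangular \<nu> \<and> bswap \<circ> \<beta> \<circ> bswap = \<mu> \<circ> bswap \<circ> \<nu>)"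
proof -
  from assms obtain \<alpha> \<gamma> \<delta> a b where nz: "\<alpha> \<noteq> 0" "\<delta> \<noteq> 0" and X: "\<beta> bX = bconst \<alpha> * bX + bconst \<gamma>"
    and Y: "\<beta> bY = bconst \<delta> * bY + bconst a * bX + bconst b"
    by (rule triangular_shear_degree_le_1E)
  have h: "alg_hom (bswap \<circ> \<beta> \<circ> bswap)"
    by (intro hom_comp hom_bswap triangular_hom tri)
  have SX: "(bswap \<circ> \<beta> \<circ> bswap) bX = bconst \<delta> * bX + bconst a * bY + bconst b"
    and SY: "(bswap \<circ> \<beta> \<circ> bswap) bY = bconst \<alpha> * bY + bconst \<gamma>"
    by (simp_all add: X Y hom_simps[OF hom_bswap])
  show ?thesis
  proof (cases "a = 0")
    case True
    then have "triangular (bswap \<circ> \<beta> \<circ> bswap)"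
      using nz SX SY by (intro triangularI[OF h, of \<delta> \<alpha> b "[:\<gamma>:]"]) (auto simp: bconst_0, simp add: bconst_def)
    then show ?thesis ..
  next
    case False
    \<comment> \<open>\<open>\<mu> bY\<close> must be the image of x under the left side; the
      coefficients of \<open>\<nu> bY\<close> then express the image of y through x and this
      polynomial.\<close>
    define \<mu> where "\<mu> = bsubst bX (bconst a * bY + [:[:b, \<delta>:]:])"
    define \<nu> where "\<nu> = bsubst bX (bconst (- \<alpha> * \<delta> / a) * bY + [:[:\<gamma> - \<alpha> * b / a, \<alpha> / a:]:])"
    have h\<mu>: "alg_hom \<mu>" and h\<nu>: "alg_hom \<nu>" by (simp_all add: \<mu>_def \<nu>_def hom_bsubst)
    have "triangular \<mu>"
      by (rule triangularI[OF h\<mu>, where \<alpha> = 1 and \<delta> = a and \<gamma> = 0])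
         (use False in \<open>simp_all add: \<mu>_def bconst_1 bconst_0\<close>)
    moreover have "triangular \<nu>"
      by (rule triangularI[OF h\<nu>, where \<alpha> = 1 and \<delta> = "- \<alpha> * \<delta> / a" and \<gamma> = 0])
         (use False nz in \<open>simp_all add: \<nu>_def bconst_1 bconst_0\<close>)
    moreover have "bswap \<circ> \<beta> \<circ> bswap = \<mu> \<circ> bswap \<circ> \<nu>"
    proof (rule hom_eqI[OF h])
      show "alg_hom (\<mu> \<circ> bswap \<circ> \<nu>)" by (intro hom_comp hom_bswap h\<mu> h\<nu>)
      have \<mu>Y: "\<mu> bY = bconst a * bY + bconst \<delta> * bX + bconst b"
        by (simp add: \<mu>_def) (simp add: affine_X flip: affine_X add.assoc)
      show "(bswap \<circ> \<beta> \<circ> bswap) bX = (\<mu> \<circ> bswap \<circ> \<nu>) bX"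
        unfolding SX by (simp add: \<mu>Y) (simp add: \<nu>_def \<mu>Y algebra_simps)
      have "\<nu> bY = bconst (- \<alpha> * \<delta> / a) * bY + bconst (\<alpha> / a) * bX + bconst (\<gamma> - \<alpha> * b / a)"
        by (simp add: \<nu>_def) (simp add: affine_X flip: affine_X add.assoc)
      then have "(\<mu> \<circ> bswap \<circ> \<nu>) bY = bconst (- \<alpha> * \<delta> / a) * \<mu> bX + bconst (\<alpha> / a) * \<mu> bY + bconst (\<gamma> - \<alpha> * b / a)"
        by (simp add: hom_simps[OF hom_bswap] hom_simps[OF h\<mu>])
      also have "\<dots> = bconst \<alpha> * bY + bconst \<gamma>"
        unfolding \<mu>Y using False by (simp add: \<mu>_def) (simp add: bconst_def bX_def bY_def field_simps)
      finally show "(bswap \<circ> \<beta> \<circ> bswap) bY = (\<mu> \<circ> bswap \<circ> \<nu>) bY" by (simp only: SY)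
    qed
    ultimately show ?thesis by blast
  qed
qed

lemma affine_conjugate_triangular:
  fixes \<beta> :: "'a::alg_closed_field bipoly \<Rightarrow> 'a bipoly"
  assumes tri: "triangular \<beta>" and deg: "shear_degree \<beta> \<le> 1"
  shows "\<exists>\<sigma>. conjugate (\<beta> \<circ> bswap) \<sigma> \<and> triangular \<sigma>"
proof -
  from assms obtain \<alpha> \<gamma> \<delta> a b where nz: "\<alpha> \<noteq> 0" "\<delta> \<noteq> 0" and X: "\<beta> bX = bconst \<alpha> * bX + bconst \<gamma>"
    and Y: "\<beta> bY = bconst \<delta> * bY + bconst a * bX + bconst b"
    by (rule triangular_shear_degree_le_1E)
  \<comment> \<open>\<open>x + s y\<close> is an eigenvector of the linear part.\<close>
  obtain s where "poly [:- \<delta>, a, \<alpha>:] s = 0"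
    using alg_closed_imp_poly_has_root[of "[:- \<delta>, a, \<alpha>:]"] nz by auto
  then have s: "(a + s * \<alpha>) * s = \<delta>" by (simp add: algebra_simps)
  then have nz': "a + s * \<alpha> \<noteq> 0" "s \<noteq> 0" using nz by auto
  define \<kappa> where "\<kappa> = bsubst (bX + bconst s * bY) bY"
  define \<sigma> where "\<sigma> = bsubst (bconst (a + s * \<alpha>) * bX + bconst (b + s * \<gamma>)) (bconst (- \<alpha> * s) * bY + [:[:\<gamma>, \<alpha>:]:])"
  have h\<kappa>: "alg_hom \<kappa>" and h\<sigma>: "alg_hom \<sigma>" by (simp_all add: \<kappa>_def \<sigma>_def hom_bsubst)
  have \<kappa>: "is_K_algebra_aut \<kappa>"
    unfolding \<kappa>_def
    by (rule aut_bsubstI[where a' = "bX - bconst s * bY" and b' = bY]) (simp_all add: hom_simps[OF hom_bsubst])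
  have "triangular \<sigma>"
    by (rule triangularI[OF h\<sigma>]) (use nz nz' in \<open>auto simp: \<sigma>_def\<close>)
  moreover have "\<kappa> \<circ> \<sigma> = (\<beta> \<circ> bswap) \<circ> \<kappa>"
  proof (rule hom_eqI)
    have "(\<kappa> \<circ> \<sigma>) bX = bconst (a + s * \<alpha>) * bX + bconst ((a + s * \<alpha>) * s) * bY + bconst (b + s * \<gamma>)"
      by (simp add: \<sigma>_def hom_simps[OF h\<kappa>]) (simp add: \<kappa>_def distrib_left mult.assoc bconst_mult)
    also have "\<dots> = \<beta> (bswap (\<kappa> bX))"
      unfolding s by (simp add: \<kappa>_def hom_simps[OF hom_bswap] hom_simps[OF triangular_hom[OF tri]] X Y)
        (simp add: algebra_simps bconst_mult bconst_add)
    finally show "(\<kappa> \<circ> \<sigma>) bX = ((\<beta> \<circ> bswap) \<circ> \<kappa>) bX" by simp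
    have "(\<kappa> \<circ> \<sigma>) bY = bconst (- \<alpha> * s) * bY + (bconst \<alpha> * (bX + bconst s * bY) + bconst \<gamma>)"
      by (simp add: \<sigma>_def flip: affine_X) (simp add: hom_simps[OF h\<kappa>], simp add: \<kappa>_def)
    also have "\<dots> = bconst \<alpha> * bX + bconst \<gamma>"
      by (simp add: algebra_simps bconst_minus bconst_mult)
    finally show "(\<kappa> \<circ> \<sigma>) bY = ((\<beta> \<circ> bswap) \<circ> \<kappa>) bY" by (simp add: \<kappa>_def X)
  qed (intro hom_comp h\<kappa> h\<sigma> hom_bswap triangular_hom tri)+
  ultimately show ?thesis using conjugateI[OF \<kappa>] by blast
qed

definition normal_form :: "('a::field bipoly \<Rightarrow> 'a bipoly) \<Rightarrow> bool" where
  "normal_form \<sigma> \<longleftrightarrow> triangular \<sigma> \<or>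
     (\<exists>\<beta>s. \<beta>s \<noteq> [] \<and> (\<forall>\<beta>\<in>set \<beta>s. triangular \<beta> \<and> shear_degree \<beta> \<ge> 2) \<and> \<sigma> = swap_prod \<beta>s)"

text \<open>An affine factor is rotated to the front and the last factor of the rotated word is
  moved before it, which encloses it between two swaps. \<open>swap_triangular_swap\<close> then
  leaves at most one of these, and the neighbouring triangular maps merge, so the word gets shorter.
  If the affine factor is the whole word, an eigenvector makes it triangular.\<close>

lemma swap_prod_conjugate_normal_form:
  fixes \<beta>s :: "('a::alg_closed_field bipoly \<Rightarrow> 'a bipoly) list"
  assumes "\<forall>\<beta>\<in>set \<beta>s. triangular \<beta>"
  shows "\<exists>\<sigma>. conjugate (swap_prod \<beta>s) \<sigma> \<and> normal_form \<sigma>"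
  using assms
proof (induction "length \<beta>s" arbitrary: \<beta>s rule: less_induct)
  case less
  have step: "\<exists>\<sigma>. conjugate (swap_prod \<beta>s) \<sigma> \<and> normal_form \<sigma>"
    if "conjugate (swap_prod \<beta>s) (swap_prod \<gamma>s)" "length \<gamma>s < length \<beta>s" "\<forall>\<beta>\<in>set \<gamma>s. triangular \<beta>" for \<gamma>s
    using less.hyps[OF that(2,3)] that(1) conjugate_trans by blast
  show ?case
  proof (cases "\<forall>\<beta>\<in>set \<beta>s. shear_degree \<beta> \<ge> 2")
    case True
    have "normal_form (swap_prod \<beta>s)"
    proof (cases "\<beta>s = []")
      case True
      then show ?thesis by (simp add: normal_form_def triangular_id)
    next
      case False
      then show ?thesis using less.prems True unfolding normal_form_def by blast
    qed
    then show ?thesis using conjugate_refl by blast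
  next
    case False
    then obtain \<beta> xs ys where bs: "\<beta>s = xs @ \<beta> # ys" and deg: "shear_degree \<beta> \<le> 1"
      by (auto simp: not_le in_set_conv_decomp)
    have tri: "triangular \<beta>" "\<forall>\<beta>\<in>set xs. triangular \<beta>" "\<forall>\<beta>\<in>set ys. triangular \<beta>"
      using less.prems bs by auto
    define zs where "zs = ys @ xs"
    have len: "length \<beta>s = Suc (length zs)" by (simp add: bs zs_def)
    have tz: "\<forall>\<beta>\<in>set zs. triangular \<beta>" using tri by (auto simp: zs_def)
    have c1: "conjugate (swap_prod \<beta>s) (swap_prod (\<beta> # zs))"
      using conjugate_comp_commute[OF aut_swap_prod[OF tri(2)], of "swap_prod (\<beta> # ys)"]
      by (simp add: bs zs_def swap_prod_append comp_assoc)
    show ?thesis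
    proof (cases zs rule: rev_cases)
      case Nil
      then have "conjugate (swap_prod \<beta>s) (\<beta> \<circ> bswap)" using c1 by simp
      then show ?thesis using affine_conjugate_triangular[OF tri(1) deg] conjugate_trans
        unfolding normal_form_def by blast
    next
      case (snoc us \<epsilon>)
      have te: "triangular \<epsilon>" and tu: "\<forall>\<beta>\<in>set us. triangular \<beta>" using tz snoc by auto
      have len': "length \<beta>s = length us + 2" using len snoc by simp
      have "conjugate (swap_prod (\<beta> # us) \<circ> swap_prod [\<epsilon>]) (swap_prod [\<epsilon>] \<circ> swap_prod (\<beta> # us))"
        by (rule conjugate_comp_commute, rule aut_swap_prod) (use tri tu in auto)
      then have "conjugate (swap_prod (\<beta> # zs)) (\<epsilon> \<circ> (bswap \<circ> \<beta> \<circ> bswap) \<circ> swap_prod us)"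
        by (simp add: snoc swap_prod_append comp_assoc)
      then have c2: "conjugate (swap_prod \<beta>s) (\<epsilon> \<circ> (bswap \<circ> \<beta> \<circ> bswap) \<circ> swap_prod us)"
        using c1 conjugate_trans by blast
      from swap_triangular_swap[OF tri(1) deg] show ?thesis
      proof (elim disjE exE conjE)
        assume t: "triangular (bswap \<circ> \<beta> \<circ> bswap)"
        define \<eta> where "\<eta> = bswap \<circ> \<beta> \<circ> bswap"
        note t = t[folded \<eta>_def] and c2 = c2[folded \<eta>_def]
        show ?thesis
        proof (cases us)
          case Nil
          then show ?thesis using c2 t te triangular_comp unfolding normal_form_def
            by (intro exI[of _ "\<epsilon> \<circ> \<eta>"]) auto
        next
          case (Cons u vs)
          show ?thesis
            by (rule step[of "(\<epsilon> \<circ> \<eta> \<circ> u) # vs"])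
               (use c2 Cons len' tu t te in \<open>auto simp: comp_assoc intro!: triangular_comp\<close>)
        qed
      next
        fix \<mu> \<nu> assume mn: "triangular \<mu>" "triangular \<nu>" "bswap \<circ> \<beta> \<circ> bswap = \<mu> \<circ> bswap \<circ> \<nu>"
        show ?thesis
        proof (cases us)
          case Nil
          have "conjugate (\<epsilon> \<circ> \<mu> \<circ> bswap \<circ> \<nu>) (\<nu> \<circ> (\<epsilon> \<circ> \<mu> \<circ> bswap))"
            by (rule conjugate_comp_commute) (intro aut_comp aut_triangular te mn aut_bswap)
          then have "conjugate (swap_prod \<beta>s) (swap_prod [\<nu> \<circ> \<epsilon> \<circ> \<mu>])"
            using c2 Nil mn(3) conjugate_trans by (simp add: comp_assoc) blast
          then show ?thesis
            by (rule step) (use Nil len' mn te in \<open>auto intro!: triangular_comp\<close>)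
        next
          case (Cons u vs)
          show ?thesis
            by (rule step[of "(\<epsilon> \<circ> \<mu>) # (\<nu> \<circ> u) # vs"])
               (use c2[unfolded mn(3)] Cons len' tu mn(1,2) te in \<open>auto simp: comp_assoc intro!: triangular_comp\<close>)
        qed
      qed
    qed
  qed
qed

theorem aut_conjugate_normal_form:
  fixes \<rho> :: "'a::{alg_closed_field, field_char_0} bipoly \<Rightarrow> 'a bipoly"
  assumes "is_K_algebra_aut \<rho>"
  shows "\<exists>\<sigma>. conjugate \<rho> \<sigma> \<and> normal_form \<sigma>"
proof -
  obtain \<beta>s \<beta> where t: "\<forall>\<beta>\<in>set \<beta>s. triangular \<beta>" "triangular \<beta>" and \<rho>: "\<rho> = swap_prod \<beta>s \<circ> \<beta>"
    using tame_aut[OF assms] by (auto simp: tame_def)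
  show ?thesis
  proof (cases \<beta>s)
    case Nil
    then show ?thesis using t \<rho> conjugate_refl by (auto simp: normal_form_def)
  next
    case (Cons b bs)
    \<comment> \<open>The trailing triangular factor has no swap; conjugation brings it to the
      front, where the first letter absorbs it.\<close>
    have "conjugate \<rho> (swap_prod ((\<beta> \<circ> b) # bs))"
      unfolding \<rho> using conjugate_comp_commute[OF aut_swap_prod[OF t(1)], of \<beta>]
      by (simp add: Cons comp_assoc)
    moreover have "\<forall>\<beta>\<in>set ((\<beta> \<circ> b) # bs). triangular \<beta>"
      using t Cons by (auto intro: triangular_comp)
    ultimately show ?thesis using swap_prod_conjugate_normal_form conjugate_trans by blast
  qed
qed

section \<open>Compositions of generalised Henon maps\<close>

text \<open>The leading form of \<open>f\<close> is a nonzero multiple of x^d: dehomogenised, it is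
  constant in u.\<close>

definition x_dominant :: "nat \<Rightarrow> 'a::field bipoly \<Rightarrow> bool" where
  "x_dominant d f \<longleftrightarrow> degree (thom f) = d \<and> (\<exists>c. c \<noteq> 0 \<and> coeff (thom f) d = [:c:])"

lemma x_dominant_tdeg: "x_dominant d f \<Longrightarrow> tdeg f = d"
  by (simp add: x_dominant_def tdeg_def)

lemma x_dominant_X: "x_dominant 1 bX"
  by (simp add: x_dominant_def) (simp add: bY_def one_pCons)

lemma x_dominant_add_left:
  assumes "x_dominant d f" "tdeg g < d"
  shows "x_dominant d (g + f)"
proof -
  have "degree (thom g + thom f) = d"
    using assms unfolding x_dominant_def tdeg_def by (metis degree_add_eq_right)
  then show ?thesis using assms unfolding x_dominant_def tdeg_def by (simp add: thom_simps coeff_eq_0)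
qed

lemma tdeg_scale: "c \<noteq> 0 \<Longrightarrow> tdeg (bconst c * f) = tdeg f"
  by (simp add: tdeg_def thom_simps) (simp add: bconst_def)

lemma x_dominant_scale: "x_dominant d f \<Longrightarrow> c \<noteq> 0 \<Longrightarrow> x_dominant d (bconst c * f)"
  by (auto simp: x_dominant_def thom_simps) (auto simp: bconst_def)

lemma tdeg_const [simp]: "tdeg (bconst c) = 0"
  by (auto simp: tdeg_eq_0_iff)

lemma hom_const_poly_eq_pcompose:
  assumes "alg_hom \<psi>"
  shows "\<psi> [:p:] = pcompose (map_poly (\<lambda>c. [:c:]) p) (\<psi> bX)"
proof (induction p)
  case 0
  then show ?case by (simp add: hom_0[OF assms])
next
  case (pCons c p)
  then show ?case
    by (simp add: hom_const_pCons[OF assms] map_poly_pCons pcompose_pCons) (simp add: bconst_def)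
qed

lemma x_dominant_poly:
  assumes h: "alg_hom \<sigma>" and dom: "x_dominant d (\<sigma> bX)" and d: "d > 0" and p: "p \<noteq> 0"
  shows "x_dominant (degree p * d) (\<sigma> [:p:])"
proof -
  obtain c where c: "c \<noteq> 0" "coeff (thom (\<sigma> bX)) d = [:c:]" "degree (thom (\<sigma> bX)) = d"
    using dom by (auto simp: x_dominant_def)
  have eq: "thom (\<sigma> [:p:]) = pcompose (map_poly (\<lambda>c. [:c:]) p) (thom (\<sigma> bX))"
    using hom_const_poly_eq_pcompose[OF hom_comp[OF hom_thom h]] by simp
  have deg: "degree (map_poly (\<lambda>c. [:c:]) p) = degree p" by (rule degree_map_poly) auto
  have 1: "degree (thom (\<sigma> [:p:])) = degree p * d" by (simp add: eq degree_pcompose deg c)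
  have "lead_coeff (thom (\<sigma> [:p:])) = [:lead_coeff p:] * [:c:] ^ degree p"
    unfolding eq by (subst lead_coeff_comp) (use c d in \<open>simp_all add: deg coeff_map_poly\<close>)
  moreover have "[:c:] ^ k = [:c ^ k:]" for k by (induction k) (auto simp: one_pCons)
  ultimately have "coeff (thom (\<sigma> [:p:])) (degree p * d) = [:lead_coeff p * c ^ degree p:]"
    by (simp add: 1)
  then show ?thesis using 1 c p by (auto simp: x_dominant_def)
qed

definition shear_prod :: "('a::field bipoly \<Rightarrow> 'a bipoly) list \<Rightarrow> nat" where
  "shear_prod \<beta>s = prod_list (map shear_degree \<beta>s)"

lemma shear_prod_simps [simp]: "shear_prod [] = 1" "shear_prod (\<beta> # \<beta>s) = shear_degree \<beta> * shear_prod \<beta>s"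
  "shear_prod (xs @ ys) = shear_prod xs * shear_prod ys" "shear_prod (rev xs) = shear_prod xs"
  by (simp_all add: shear_prod_def prod_list.rev flip: rev_map)

lemma triangular_shear_degreeE:
  assumes "triangular \<beta>"
  obtains \<alpha> \<gamma> \<delta> p where "\<alpha> \<noteq> 0" "\<delta> \<noteq> 0" "\<beta> bX = bconst \<alpha> * bX + bconst \<gamma>"
    "\<beta> bY = bconst \<delta> * bY + [:p:]" "degree p = shear_degree \<beta>"
proof -
  obtain \<alpha> \<gamma> \<delta> p where 1: "\<alpha> \<noteq> 0" "\<delta> \<noteq> 0" "\<beta> bX = bconst \<alpha> * bX + bconst \<gamma>"
    "\<beta> bY = bconst \<delta> * bY + [:p:]"
    using assms by (auto simp: triangular_def)
  then have "degree p = shear_degree \<beta>" by (simp add: shear_degree_def) (simp add: bconst_def bY_def)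
  then show ?thesis using that 1 by blast
qed

definition henon_factor :: "('a::field bipoly \<Rightarrow> 'a bipoly) \<Rightarrow> bool" where
  "henon_factor \<beta> \<longleftrightarrow> triangular \<beta> \<and> shear_degree \<beta> \<ge> 2"

lemma shear_prod_pos: "\<forall>\<beta>\<in>set \<beta>s. henon_factor \<beta> \<Longrightarrow> shear_prod \<beta>s > 0"
  by (induction \<beta>s) (auto simp: henon_factor_def)

text \<open>A factor appended on the right acts first: the new x-component is \<delta> \<sigma>(y) +
  p(\<sigma>(x)), the new y-component \<alpha> \<sigma>(x) + \<gamma>. Since deg p \<ge> 2, the term
  p(\<sigma>(x)) dominates and the degrees multiply.\<close>

lemma swap_prod_X:
  assumes "\<forall>\<beta>\<in>set \<beta>s. henon_factor \<beta>"
  shows "x_dominant (shear_prod \<beta>s) (swap_prod \<beta>s bX) \<and> tdeg (swap_prod \<beta>s bY) \<le> shear_prod \<beta>s"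
  using assms
proof (induction \<beta>s rule: rev_induct)
  case Nil
  have "tdeg (bY :: 'a bipoly) = 1" by (simp add: tdeg_def) (simp add: bX_def bY_def)
  then show ?case using x_dominant_X by simp
next
  case (snoc \<beta> \<beta>s)
  define \<sigma> where "\<sigma> = swap_prod \<beta>s"
  define d where "d = shear_prod \<beta>s"
  have hf: "henon_factor \<beta>" "\<forall>\<beta>\<in>set \<beta>s. henon_factor \<beta>" using snoc.prems by auto
  have IH: "x_dominant d (\<sigma> bX)" "tdeg (\<sigma> bY) \<le> d" using snoc.IH hf by (auto simp: \<sigma>_def d_def)
  have d: "d > 0" using shear_prod_pos[OF hf(2)] by (simp add: d_def)
  have h: "alg_hom \<sigma>"
    unfolding \<sigma>_def using hf(2) by (intro aut_hom aut_swap_prod) (auto simp: henon_factor_def)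
  obtain \<alpha> \<gamma> \<delta> p where nz: "\<alpha> \<noteq> 0" "\<delta> \<noteq> 0" and X: "\<beta> bX = bconst \<alpha> * bX + bconst \<gamma>"
    and Y: "\<beta> bY = bconst \<delta> * bY + [:p:]" and p: "degree p = shear_degree \<beta>"
    using hf(1) unfolding henon_factor_def by (auto elim: triangular_shear_degreeE)
  have p2: "degree p \<ge> 2" using hf(1) p by (simp add: henon_factor_def)
  have big: "d < degree p * d" using d p2 by simp
  have eqX: "swap_prod (\<beta>s @ [\<beta>]) bX = bconst \<delta> * \<sigma> bY + \<sigma> [:p:]"
    and eqY: "swap_prod (\<beta>s @ [\<beta>]) bY = bconst \<gamma> + bconst \<alpha> * \<sigma> bX"
    by (simp_all add: swap_prod_append X Y hom_simps[OF h] flip: \<sigma>_def)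
  have "x_dominant (degree p * d) (bconst \<delta> * \<sigma> bY + \<sigma> [:p:])"
    by (rule x_dominant_add_left, rule x_dominant_poly[OF h IH(1) d])
       (use p2 le_less_trans[OF IH(2) big] nz in \<open>auto simp: tdeg_scale\<close>)
  moreover have "x_dominant d (bconst \<gamma> + bconst \<alpha> * \<sigma> bX)"
    by (intro x_dominant_add_left x_dominant_scale IH nz) (simp add: d)
  ultimately show ?case
    using big x_dominant_tdeg unfolding eqX eqY by (fastforce simp: d_def p mult.commute)
qed

text \<open>The last factor enters the y-component only through its affine action on x, so its
  degree does not count.\<close>

lemma swap_prod_Y:
  assumes "\<forall>\<beta>\<in>set \<beta>s. henon_factor \<beta>" and "triangular \<beta>"
  shows "x_dominant (shear_prod \<beta>s) (swap_prod (\<beta>s @ [\<beta>]) bY)"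
proof -
  have h: "alg_hom (swap_prod \<beta>s)"
    using assms(1) by (intro aut_hom aut_swap_prod) (auto simp: henon_factor_def)
  obtain \<alpha> \<gamma> where nz: "\<alpha> \<noteq> 0" and X: "\<beta> bX = bconst \<alpha> * bX + bconst \<gamma>"
    using assms(2) by (auto simp: triangular_def)
  have eqY: "swap_prod (\<beta>s @ [\<beta>]) bY = bconst \<gamma> + bconst \<alpha> * swap_prod \<beta>s bX"
    by (simp add: swap_prod_append X hom_simps[OF h])
  show ?thesis unfolding eqY using swap_prod_X[OF assms(1)] shear_prod_pos[OF assms(1)] nz
    by (intro x_dominant_add_left x_dominant_scale) auto
qed

lemma x_dominant_bswap:
  assumes "x_dominant d f"
  shows "\<exists>c. c \<noteq> 0 \<and> degree (thom (bswap f)) = d \<and> coeff (thom (bswap f)) d = monom c d"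
proof -
  obtain c where c: "c \<noteq> 0" "coeff (thom f) d = [:c:]" "degree (thom f) = d"
    using assms by (auto simp: x_dominant_def)
  have "coeff (thom (bswap f)) d = monom c d"
  proof (rule poly_eqI)
    fix j
    have "coeff (coeff (thom (bswap f)) d) j = (if j \<le> d then coeff (coeff (thom f) d) (d - j) else 0)"
      by (simp add: coeff_thom coeff_bswap)
    then show "coeff (coeff (thom (bswap f)) d) j = coeff (monom c d) j"
      using c by (auto simp: coeff_pCons split: nat.splits)
  qed
  moreover have "degree (thom (bswap f)) = d" using tdeg_bswap[of f] c(3) by (simp add: tdeg_def)
  ultimately show ?thesis using c by blast
qed

lemma henon_factor_inv:
  assumes "henon_factor \<beta>"
  shows "henon_factor (inv \<beta>)" "shear_degree (inv \<beta>) = shear_degree \<beta>"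
proof -
  have tri: "triangular \<beta>" using assms by (simp add: henon_factor_def)
  note a = aut_triangular[OF tri] and h = triangular_hom[OF tri]
  obtain \<alpha> \<gamma> \<delta> p where nz: "\<alpha> \<noteq> 0" "\<delta> \<noteq> 0" and X: "\<beta> bX = bconst \<alpha> * bX + bconst \<gamma>"
    and Y: "\<beta> bY = bconst \<delta> * bY + [:p:]" and p: "degree p = shear_degree \<beta>"
    using tri by (auto elim: triangular_shear_degreeE)
  note hi = hom_inv[OF a]
  have c1: "bconst (1 / \<alpha>) * bconst \<alpha> = 1" "bconst (1 / \<delta>) * bconst \<delta> = 1"
    using nz by (simp_all add: bconst_1 flip: bconst_mult)
  have "bX = bconst \<alpha> * inv \<beta> bX + bconst \<gamma>"
    using arg_cong[OF X, of "inv \<beta>"] by (simp add: aut_inv_left_apply[OF a] hom_simps[OF hi])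
  then have "bconst (1 / \<alpha>) * (bX - bconst \<gamma>) = (bconst (1 / \<alpha>) * bconst \<alpha>) * inv \<beta> bX"
    by (metis add_diff_cancel_right' mult.assoc)
  then have X': "inv \<beta> bX = bconst (1 / \<alpha>) * bX + bconst (- \<gamma> / \<alpha>)"
    unfolding c1 by (simp add: algebra_simps bconst_minus flip: bconst_mult)
  define q where "q = pcompose p [:- \<gamma> / \<alpha>, 1 / \<alpha>:]"
  have "bY = bconst \<delta> * inv \<beta> bY + inv \<beta> [:p:]"
    using arg_cong[OF Y, of "inv \<beta>"] by (simp add: aut_inv_left_apply[OF a] hom_simps[OF hi])
  then have "bconst (1 / \<delta>) * (bY - [:q:]) = (bconst (1 / \<delta>) * bconst \<delta>) * inv \<beta> bY"
    using hom_const_poly_affine[OF hi X', of p] by (metis add_diff_cancel_right' mult.assoc q_def)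
  then have "inv \<beta> bY = bconst (1 / \<delta>) * (bY - [:q:])" unfolding c1 by simp
  also have "\<dots> = bconst (1 / \<delta>) * bY + [:smult (- 1 / \<delta>) q:]"
    by (simp add: bconst_def bY_def)
  finally have Y': "inv \<beta> bY = bconst (1 / \<delta>) * bY + [:smult (- 1 / \<delta>) q:]" .
  have "triangular (inv \<beta>)"
    by (rule triangularI[OF hi _ _ X' Y']) (use nz in auto)
  moreover show "shear_degree (inv \<beta>) = shear_degree \<beta>"
    using nz by (simp add: shear_degree_def[of "inv \<beta>"] Y') (simp add: bconst_def bY_def q_def p degree_pcompose)
  ultimately show "henon_factor (inv \<beta>)" using assms by (simp add: henon_factor_def)
qed

text \<open>Inverting the word puts each swap before its factor; the outer swaps restore the shape
  of \<open>swap_prod\<close>. The left one turns leading forms in x into leading forms in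
  y.\<close>

lemma inv_swap_prod:
  assumes "\<forall>\<beta>\<in>set \<beta>s. triangular \<beta>"
  shows "inv (swap_prod \<beta>s) = bswap \<circ> swap_prod (rev (map inv \<beta>s)) \<circ> bswap"
proof -
  define \<tau> where "\<tau> xs = bswap \<circ> swap_prod (rev (map inv xs)) \<circ> bswap" for xs :: "('a bipoly \<Rightarrow> 'a bipoly) list"
  have "\<tau> \<beta>s \<circ> swap_prod \<beta>s = id"
    using assms
  proof (induction \<beta>s)
    case Nil
    then show ?case by (simp add: \<tau>_def bswap_comp_bswap)
  next
    case (Cons \<beta> \<beta>s)
    have "inv \<beta> (\<beta> f) = f" for f using Cons.prems by (simp add: aut_inv_left_apply aut_triangular)
    then have "\<tau> (\<beta> # \<beta>s) \<circ> swap_prod (\<beta> # \<beta>s) = \<tau> \<beta>s \<circ> swap_prod \<beta>s"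
      by (simp add: \<tau>_def swap_prod_append fun_eq_iff)
    also have "\<dots> = id" by (rule Cons.IH) (use Cons.prems in simp)
    finally show ?case .
  qed
  then have "\<tau> \<beta>s (swap_prod \<beta>s f) = f" for f by (metis comp_apply id_apply)
  then have "\<tau> \<beta>s g = inv (swap_prod \<beta>s) g" for g
    using aut_inv_right_apply[OF aut_swap_prod[OF assms]] by metis
  then show ?thesis unfolding \<tau>_def by (simp add: fun_eq_iff)
qed

text \<open>The leading form of F is c y^e, that of G contains x^d. Reducing u modulo F gives r G +
  s F = k with r of degree below e in y. If r is nonzero the leading forms cancel, so y^e divides
  the product of those of r and G. But y does not divide the form of G, and the form of r has degree
  below e in y.\<close>

lemma coprime_leading_forms:
  fixes F G :: "'a::field bipoly"
  assumes F: "degree (thom F) = e" "coeff (thom F) e = monom c e" "c \<noteq> 0" "e > 0"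
    and G: "degree (thom G) = d" "coeff (coeff (thom G) d) 0 \<noteq> 0" "d > 0"
  shows "u * G + v * F \<noteq> 1"
proof
  assume eq: "u * G + v * F = 1"
  have "coeff F e = [:c:]"
  proof (rule poly_eqI)
    show "coeff (coeff F e) i = coeff [:c:] i" for i
      using F by (cases "i = 0") (simp_all add: coeff_eq_coeff_thom coeff_eq_0 coeff_pCons split: nat.splits)
  qed
  moreover have "degree F \<le> e"
  proof (rule degree_le, intro allI impI poly_eqI)
    show "coeff (coeff F j) i = coeff 0 i" if "e < j" for i j
      using F that by (simp add: coeff_eq_coeff_thom coeff_eq_0)
  qed
  ultimately have degF: "degree F = e" "lead_coeff F = [:c:]"
    using F(3) le_degree[of F e] by auto
  have F0: "F \<noteq> 0" using degF F(4) by auto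
  \<comment> \<open>The leading coefficient of \<open>F\<close> in y is the constant
    \<open>c\<close>, so this is division with remainder up to a nonzero scalar.\<close>
  obtain q r where qr: "pseudo_divmod u F = (q, r)" by fastforce
  define N where "N = Suc (degree u) - degree F"
  have pd: "smult ([:c:] ^ N) u = F * q + r" and r: "r = 0 \<or> degree r < e"
    using pseudo_divmod[OF F0 qr, unfolded degF(2)] degF(1) unfolding N_def by auto
  have cN: "[:c:] ^ N = [:c ^ N:]" by (induction N) (auto simp: one_pCons)
  define k where "k = c ^ N"
  have k: "k \<noteq> 0" using F(3) by (simp add: k_def)
  define s where "s = q * G + bconst k * v"
  have "bconst k * u = F * q + r" using pd cN by (simp add: bconst_def k_def)
  then have "r * G + s * F = bconst k * (u * G + v * F)"
    unfolding s_def by (simp only: distrib_left mult.assoc[symmetric]) (simp add: algebra_simps)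
  then have "thom r * thom G + thom s * thom F = bconst k"
    unfolding eq by (simp add: thom_simps flip: hom_mult[OF hom_thom] hom_add[OF hom_thom])
  then have sF: "thom s * thom F = bconst k - thom r * thom G" by (simp add: eq_diff_eq add.commute)
  have G0: "thom G \<noteq> 0" using G(1,3) by (metis degree_0 less_irrefl)
  have dk: "degree (bconst k) = 0" by (simp add: bconst_def)
  show False
  proof (cases "r = 0")
    case True
    then have "thom s * thom F = bconst k" using sF by (simp add: thom_simps)
    then have "thom F dvd bconst k" by (metis dvd_triv_right)
    then have "degree (thom F) \<le> 0" using dvd_imp_degree_le[of "thom F" "bconst k"] k dk by simp
    then show False using F by simp
  next
    case False
    have r0: "thom r \<noteq> 0" using False by simp
    have drG: "degree (thom r * thom G) > 0" using r0 G0 G by (simp add: degree_mult_eq)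
    then have "lead_coeff (thom s * thom F) = - lead_coeff (thom r * thom G)"
      using lead_coeff_add_le[of "bconst k" "- (thom r * thom G)"] dk by (simp add: sF)
    then have "lead_coeff (thom r) * lead_coeff (thom G) = - lead_coeff (thom s) * monom c e"
      using F by (simp only: lead_coeff_mult) simp
    also have "\<dots> = [:- 0, 1:] ^ e * smult (- c) (lead_coeff (thom s))"
      by (simp add: monom_altdef mult.commute)
    finally have "[:- 0, 1:] ^ e dvd lead_coeff (thom r) * lead_coeff (thom G)" by (rule dvdI)
    then have "e \<le> order 0 (lead_coeff (thom r) * lead_coeff (thom G))"
      using r0 G0 by (subst (asm) order_divides) auto
    also have "\<dots> = order 0 (lead_coeff (thom r)) + order 0 (lead_coeff (thom G))"
      by (rule order_mult) (use r0 G0 in auto)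
    also have "order 0 (lead_coeff (thom G)) = 0"
      by (rule order_0I) (use G in \<open>simp add: poly_0_coeff_0\<close>)
    also have "order 0 (lead_coeff (thom r)) \<le> degree (lead_coeff (thom r))"
      by (rule order_degree) (use r0 in auto)
    also have "\<dots> \<le> degree r"
      by (rule degree_le) (auto simp: coeff_thom coeff_eq_0)
    finally show False using r False by simp
  qed
qed

text \<open>The cut is at the first factor after which the remaining product is at most the product
  before it; minimality gives the strict inequality for the shorter prefix.\<close>

lemma balanced_split:
  assumes "\<beta>s \<noteq> []" "\<forall>\<beta>\<in>set \<beta>s. henon_factor \<beta>"
  shows "\<exists>xs \<beta> ys. \<beta>s = xs @ \<beta> # ys \<and> shear_prod ys \<le> shear_prod xs \<and>
    (\<forall>xs' \<alpha>. xs = xs' @ [\<alpha>] \<longrightarrow> shear_prod xs' < shear_prod (\<beta> # ys))"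
proof -
  define P where "P m \<longleftrightarrow> m < length \<beta>s \<and> shear_prod (drop (Suc m) \<beta>s) \<le> shear_prod (take m \<beta>s)" for m
  have "P (length \<beta>s - 1)"
    using assms shear_prod_pos[of "take (length \<beta>s - 1) \<beta>s"] unfolding P_def
    by (auto simp: Suc_le_eq dest!: in_set_takeD)
  then obtain m where m: "P m" "\<And>m'. m' < m \<Longrightarrow> \<not> P m'" using exists_least_iff[of P] by blast
  have split: "\<beta>s = take m \<beta>s @ \<beta>s ! m # drop (Suc m) \<beta>s"
    using m(1) by (simp add: P_def id_take_nth_drop)
  have "shear_prod xs' < shear_prod (\<beta>s ! m # drop (Suc m) \<beta>s)" if "take m \<beta>s = xs' @ [\<alpha>]" for xs' \<alpha>
  proof -
    have len: "m = Suc (length xs')"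
      using arg_cong[OF that, of length] m(1) by (simp add: P_def)
    have "xs' = take (length xs') (take m \<beta>s)" using that by simp
    also have "\<dots> = take (length xs') \<beta>s" using len by simp
    finally have xs': "xs' = take (length xs') \<beta>s" .
    have "\<not> P (length xs')" using m(2) len by simp
    then have "shear_prod xs' < shear_prod (drop m \<beta>s)"
      using m(1) len xs' unfolding P_def by (metis Suc_lessD not_le)
    moreover have "drop m \<beta>s = \<beta>s ! m # drop (Suc m) \<beta>s"
      using m(1) by (simp add: P_def Cons_nth_drop_Suc)
    ultimately show ?thesis by simp
  qed
  then show ?thesis using split m(1) unfolding P_def by blast
qed

text \<open>Writing the composition as \<open>\<sigma> \<tau>\<inverse>\<close> with factors of balanced degrees makes the leading
  forms of the equations \<open>\<sigma> = \<tau>\<close> of the fixed points coprime.\<close>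
lemma simple_not_henon:
  fixes D :: "'a::field_char_0 bipoly \<Rightarrow> 'a bipoly"
  assumes D: "simple_derivation D" and comm: "swap_prod \<beta>s \<circ> D = D \<circ> swap_prod \<beta>s"
    and ne: "\<beta>s \<noteq> []" and hf: "\<forall>\<beta>\<in>set \<beta>s. henon_factor \<beta>"
  shows False
proof -
  obtain xs \<beta> ys where bs: "\<beta>s = xs @ \<beta> # ys" and le: "shear_prod ys \<le> shear_prod xs"
    and less: "\<And>xs' \<alpha>. xs = xs' @ [\<alpha>] \<Longrightarrow> shear_prod xs' < shear_prod (\<beta> # ys)"
    using balanced_split[OF ne hf] by blast
  have hf': "henon_factor \<beta>" "\<forall>\<beta>\<in>set xs. henon_factor \<beta>" "\<forall>\<beta>\<in>set ys. henon_factor \<beta>"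
    using hf bs by auto
  define \<sigma> where "\<sigma> = swap_prod xs"
  define \<rho> where "\<rho> = swap_prod (\<beta> # ys)"
  define \<tau> where "\<tau> = inv \<rho>"
  define cs where "cs = rev (map inv ys)"
  have tri: "\<forall>\<beta>\<in>set (\<beta> # ys). triangular \<beta>" "\<forall>\<beta>\<in>set xs. triangular \<beta>"
    using hf' by (auto simp: henon_factor_def)
  have a\<rho>: "is_K_algebra_aut \<rho>" unfolding \<rho>_def by (rule aut_swap_prod[OF tri(1)])
  have \<tau>: "\<tau> = bswap \<circ> swap_prod (cs @ [inv \<beta>]) \<circ> bswap"
    unfolding \<tau>_def \<rho>_def cs_def inv_swap_prod[OF tri(1)] by simp
  have hcs: "\<forall>\<beta>\<in>set (cs @ [inv \<beta>]). henon_factor \<beta>" "\<forall>\<beta>\<in>set cs. henon_factor \<beta>"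
    using hf' henon_factor_inv(1) by (auto simp: cs_def)
  have "shear_prod (map inv zs) = shear_prod zs" if "\<forall>\<beta>\<in>set zs. henon_factor \<beta>"
    for zs :: "('a bipoly \<Rightarrow> 'a bipoly) list"
    using that by (induction zs) (auto simp: henon_factor_inv)
  then have pcs: "shear_prod cs = shear_prod ys" "shear_prod (cs @ [inv \<beta>]) = shear_prod (\<beta> # ys)"
    using hf' by (simp_all add: cs_def henon_factor_inv mult.commute)
  \<comment> \<open>The degrees of \<open>\<sigma> bX\<close>, \<open>\<tau> bY\<close> and
    \<open>\<tau> bX\<close>, in this order.\<close>
  define d e e' where "d = shear_prod xs" "e = shear_prod (\<beta> # ys)" "e' = shear_prod ys"
  have pos: "d > 0" "e' > 0" using shear_prod_pos hf' by (auto simp: d_e_e'_def)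
  have "e = shear_degree \<beta> * e'" by (simp add: d_e_e'_def)
  then have e2: "e \<ge> 2" using hf'(1) pos(2) unfolding henon_factor_def
    by (metis One_nat_def Suc_leI mult_le_mono nat_mult_1_right)
  have "x_dominant e (swap_prod (cs @ [inv \<beta>]) bX)"
    using swap_prod_X[OF hcs(1)] unfolding pcs d_e_e'_def by blast
  from x_dominant_bswap[OF this] obtain c where
    c: "c \<noteq> 0" "degree (thom (\<tau> bY)) = e" "coeff (thom (\<tau> bY)) e = monom c e"
    by (auto simp: \<tau>)
  have "x_dominant e' (swap_prod (cs @ [inv \<beta>]) bY)"
    using swap_prod_Y[OF hcs(2), of "inv \<beta>"] hcs(1) pcs by (simp add: d_e_e'_def henon_factor_def)
  from x_dominant_bswap[OF this] obtain c' where
    c': "degree (thom (\<tau> bX)) = e'" "coeff (thom (\<tau> bX)) e' = monom c' e'"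
    by (auto simp: \<tau>)
  have "x_dominant d (\<sigma> bX)" using swap_prod_X[OF hf'(2)] by (simp add: \<sigma>_def d_e_e'_def)
  then obtain c'' where c'': "c'' \<noteq> 0" "degree (thom (\<sigma> bX)) = d" "coeff (thom (\<sigma> bX)) d = [:c'':]"
    by (auto simp: x_dominant_def)
  have small: "tdeg (\<sigma> bY) < e"
  proof (cases xs rule: rev_cases)
    case Nil
    then have "tdeg (\<sigma> bY) = 1" by (simp add: \<sigma>_def tdeg_def) (simp add: bX_def bY_def)
    then show ?thesis using e2 by simp
  next
    case (snoc xs' \<alpha>)
    then have "x_dominant (shear_prod xs') (\<sigma> bY)"
      unfolding \<sigma>_def using hf'(2) by (auto simp: henon_factor_def intro!: swap_prod_Y)
    then show ?thesis using less[OF snoc] by (simp add: x_dominant_tdeg d_e_e'_def)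
  qed
  define F where "F = \<sigma> bY - \<tau> bY"
  define G where "G = \<sigma> bX - \<tau> bX"
  have F: "degree (thom F) = e" "coeff (thom F) e = monom (- c) e"
  proof -
    have tF: "thom F = thom (\<sigma> bY) + - thom (\<tau> bY)" by (simp add: F_def thom_simps)
    show "degree (thom F) = e"
      unfolding tF by (subst degree_add_eq_right) (use small c in \<open>auto simp: tdeg_def\<close>)
    show "coeff (thom F) e = monom (- c) e"
      unfolding tF using small c by (simp add: tdeg_def coeff_eq_0 minus_monom)
  qed
  have G: "degree (thom G) = d" "coeff (coeff (thom G) d) 0 \<noteq> 0"
  proof -
    have tG: "thom G = thom (\<sigma> bX) - thom (\<tau> bX)" by (simp add: G_def thom_simps)
    have "e' \<le> d" using le by (simp add: d_e_e'_def)
    \<comment> \<open>If the degrees coincide, the leading forms are multiples of x^d and y^d, so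
      the term in x^d survives the subtraction.\<close>
    then have "coeff (coeff (thom (\<tau> bX)) d) 0 = 0"
      using c' pos by (cases "e' = d") (auto simp: coeff_eq_0)
    then show nz: "coeff (coeff (thom G) d) 0 \<noteq> 0" using c'' by (simp add: tG)
    have "degree (thom G) \<le> d"
      unfolding tG by (rule degree_diff_le) (use c'' c' \<open>e' \<le> d\<close> in auto)
    moreover have "d \<le> degree (thom G)" using nz by (intro le_degree) auto
    ultimately show "degree (thom G) = d" by simp
  qed
  have no: "u * G + v * F \<noteq> 1" for u v
    by (rule coprime_leading_forms[OF F _ _ G]) (use c e2 pos in auto)
  have "G \<noteq> 0" using G by (auto simp: thom_simps)
  then have "\<sigma> \<noteq> \<tau>" by (auto simp: G_def)
  have \<tau>\<rho>: "\<tau> (\<rho> f) = f" "\<rho> (\<tau> f) = f" for f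
    by (simp_all add: \<tau>_def aut_inv_left_apply[OF a\<rho>] aut_inv_right_apply[OF a\<rho>])
  have prod: "swap_prod \<beta>s = \<sigma> \<circ> \<rho>" by (simp only: bs \<sigma>_def \<rho>_def swap_prod_append)
  \<comment> \<open>\<open>E\<close> is \<open>D\<close> conjugated by \<open>\<tau>\<close>. As
    \<open>\<sigma> = (\<sigma> \<circ> \<rho>) \<circ> \<tau>\<close> and
    \<open>\<sigma> \<circ> \<rho>\<close> commutes with \<open>D\<close>, the map
    \<open>\<sigma>\<close> intertwines \<open>E\<close> and \<open>D\<close> as well.\<close>
  define E where "E f = \<rho> (D (\<tau> f))" for f
  have "D (\<tau> f) = \<tau> (E f)" for f by (simp add: E_def \<tau>\<rho>)
  moreover have "D (\<sigma> f) = \<sigma> (E f)" for f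
    using fun_cong[OF comm, of "\<tau> f"] by (simp add: prod E_def \<tau>\<rho>)
  moreover have "alg_hom \<sigma>" "alg_hom \<tau>"
    unfolding \<sigma>_def \<tau>_def using aut_hom[OF aut_swap_prod[OF tri(2)]] hom_inv[OF a\<rho>] by auto
  ultimately show False
    using simple_coincidence[OF D _ _ \<open>\<sigma> \<noteq> \<tau>\<close>, of E] no unfolding F_def G_def by blast
qed

theorem theorem1p1:
  fixes D :: "'a::{alg_closed_field, field_char_0} bipoly \<Rightarrow> 'a bipoly"
  assumes "simple_derivation D"
  shows "Aut_der D = {id}"
proof
  show "{id} \<subseteq> Aut_der D" by (simp add: Aut_der_def aut_id)
  show "Aut_der D \<subseteq> {id}"
  proof
    fix \<rho> assume "\<rho> \<in> Aut_der D"
    then have \<rho>: "is_K_algebra_aut \<rho>" "\<rho> \<circ> D = D \<circ> \<rho>" by (auto simp: Aut_der_def)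
    obtain \<sigma> \<kappa> where \<sigma>: "normal_form \<sigma>" and \<kappa>: "is_K_algebra_aut \<kappa>" "\<kappa> \<circ> \<sigma> = \<rho> \<circ> \<kappa>"
      using aut_conjugate_normal_form[OF \<rho>(1)] by (auto simp: conjugate_def)
    note E = simple_conj[OF assms \<kappa>(1)] and comm = conj_commute[OF \<kappa> \<rho>(2)]
    have "triangular \<sigma>"
      using \<sigma> simple_not_henon[OF E] comm unfolding normal_form_def henon_factor_def by blast
    then have "\<sigma> = id" by (rule simple_triangular[OF E comm])
    then have "\<rho> \<circ> \<kappa> \<circ> inv \<kappa> = \<kappa> \<circ> inv \<kappa>" using \<kappa>(2) by simp
    then show "\<rho> \<in> {id}" by (simp add: comp_assoc aut_inv_right[OF \<kappa>(1)])
  qed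
qed

end
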